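(* The Edge-Walk procedure (described in the context) can be implemented such that all $T$ iterations run in a total of $O(Tmn + n^3 + Tn^2)$ time.
   Context: Edge-Walk (Lovett and Meka) takes as input vectors $v_1,\dots,v_m \in \mathbb{R}^n$ (rows of an $m\times n$ matrix), thresholds $c_1,\dots,c_m>0$, a starting point $x_0 = X_0 \in [-1,1]^n$, parameters $\delta,\gamma>0$ and a number of iterations $T$. For $t = 1,\dots,T$: (1) let $\mathcal{C}^{\mathrm{var}}_t = \{i \in [n] : |(X_{t-1})_i| \geq 1-\delta\}$; (2) let $\mathcal{C}^{\mathrm{disc}}_t = \{j \in [m] : |\langle X_{t-1} - x_0, v_j\rangle| \geq c_j - \delta\}$; (3) let $\mathcal{V}_t = \{u \in \mathbb{R}^n : u_i = 0 \ \forall i \in \mathcal{C}^{\mathrm{var}}_t,\ \langle u, v_j\rangle = 0\ \forall j \in \mathcal{C}^{\mathrm{disc}}_t\}$; (4) set $X_t := X_{t-1} + \gamma U_t$ where $U_t \sim \mathcal{N}(\mathcal{V}_t)$ is a standard Gaussian vector in the subspace $\mathcal{V}_t$ (i.e. $\sum_i g_i w_i$ for an orthonormal basis $(w_i)$ of $\mathcal{V}_t$ and independent $g_i \sim \mathcal{N}(0,1)$). The procedure is allowed to fail (stop) if $|\mathcal{C}^{\mathrm{disc}}_t| \geq n$. Running time is counted in arithmetic operations, with each standard normal sample costing $O(1)$. *)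

theory Defs
  imports "HOL-Probability.Probability"
begin

section \<open>Edge-Walk\<close>

text \<open>
  The dimension varies inside the statement, so a vector of dimension \<open>n\<close> is a function
  \<^typ>\<open>nat \<Rightarrow> real\<close> of which only the coordinates below \<open>n\<close> are relevant. Indices start at 0.
\<close>

record ew_input =
  dim :: nat                        \<comment> \<open>n\<close>
  num :: nat                        \<comment> \<open>m\<close>
  iters :: nat                      \<comment> \<open>T\<close>
  vec :: "nat \<Rightarrow> nat \<Rightarrow> real"       \<comment> \<open>\<open>vec j i\<close> is coordinate \<open>i\<close> of the vector with index \<open>j\<close>\<close>
  thr :: "nat \<Rightarrow> real"              \<comment> \<open>thresholds c\<close>
  start :: "nat \<Rightarrow> real"            \<comment> \<open>starting point\<close>
  slack :: real                     \<comment> \<open>\<open>\<delta>\<close>\<close>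
  stepsize :: real                  \<comment> \<open>\<open>\<gamma>\<close>\<close>

definition valid_input :: "ew_input \<Rightarrow> bool" where
  "valid_input I \<longleftrightarrow>
     dim I \<ge> 1 \<and>
     (\<forall>j<num I. thr I j > 0) \<and>
     (\<forall>i<dim I. start I i \<in> {-1..1}) \<and>
     slack I > 0 \<and> stepsize I > 0"

definition ip :: "nat \<Rightarrow> (nat \<Rightarrow> real) \<Rightarrow> (nat \<Rightarrow> real) \<Rightarrow> real" where
  "ip n u w = (\<Sum>i<n. u i * w i)"

definition C_var :: "ew_input \<Rightarrow> (nat \<Rightarrow> real) \<Rightarrow> nat set" where
  "C_var I x = {i. i < dim I \<and> \<bar>x i\<bar> \<ge> 1 - slack I}"

definition C_disc :: "ew_input \<Rightarrow> (nat \<Rightarrow> real) \<Rightarrow> nat set" where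
  "C_disc I x =
     {j. j < num I \<and> \<bar>ip (dim I) (\<lambda>i. x i - start I i) (vec I j)\<bar> \<ge> thr I j - slack I}"

definition V_space :: "ew_input \<Rightarrow> (nat \<Rightarrow> real) \<Rightarrow> (nat \<Rightarrow> real) set" where
  "V_space I x =
     {u. (\<forall>i\<ge>dim I. u i = 0) \<and>
         (\<forall>i\<in>C_var I x. u i = 0) \<and>
         (\<forall>j\<in>C_disc I x. ip (dim I) u (vec I j) = 0)}"

definition orthonormal_basis ::
  "nat \<Rightarrow> (nat \<Rightarrow> real) set \<Rightarrow> (nat \<Rightarrow> real) list \<Rightarrow> bool" where
  "orthonormal_basis n V ws \<longleftrightarrow>
     set ws \<subseteq> V \<and>
     (\<forall>k<length ws. \<forall>l<length ws. ip n (ws ! k) (ws ! l) = (if k = l then 1 else 0)) \<and>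
     (\<forall>u\<in>V. \<exists>a. u = (\<lambda>i. \<Sum>k<length ws. a k * (ws ! k) i))"

text \<open>
  For independent standard normal \<open>g 0, g 1, \<dots>\<close> this is a standard Gaussian vector in the
  subspace \<open>V\<close>; its law does not depend on the orthonormal basis that is chosen.
\<close>

definition gaussian_in :: "nat \<Rightarrow> (nat \<Rightarrow> real) set \<Rightarrow> (nat \<Rightarrow> real) \<Rightarrow> nat \<Rightarrow> real" where
  "gaussian_in n V g =
     (let ws = (SOME ws. orthonormal_basis n V ws)
      in (\<lambda>i. \<Sum>k<length ws. g k * (ws ! k) i))"

text \<open>The walk as a function of the normal variables; \<open>g (t, _)\<close> are those used to get from
  \<open>X\<^sub>t\<close> to \<open>X\<^bsub>t+1\<^esub>\<close>.\<close>

primrec walk :: "ew_input \<Rightarrow> (nat \<times> nat \<Rightarrow> real) \<Rightarrow> nat \<Rightarrow> nat \<Rightarrow> real" where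
  "walk I g 0 = start I"
| "walk I g (Suc t) =
     (\<lambda>i. walk I g t i
          + stepsize I * gaussian_in (dim I) (V_space I (walk I g t)) (\<lambda>k. g (t, k)) i)"

text \<open>
  The procedure may, but need not, fail as soon as at least \<open>n\<close> discrepancy constraints are tight.
  A failure rule is the set of points at which it does so.
\<close>

definition failure_rule :: "ew_input \<Rightarrow> (nat \<Rightarrow> real) set \<Rightarrow> bool" where
  "failure_rule I S \<longleftrightarrow> (\<forall>x\<in>S. card (C_disc I x) \<ge> dim I)"

text \<open>Number of completed iterations: \<open>T\<close>, unless the procedure fails.\<close>

definition completed :: "ew_input \<Rightarrow> (nat \<Rightarrow> real) set \<Rightarrow> (nat \<times> nat \<Rightarrow> real) \<Rightarrow> nat" where
  "completed I S g = Min (insert (iters I) {t. t < iters I \<and> walk I g t \<in> S})"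

text \<open>
  A run is the number \<open>\<tau>\<close> of completed iterations together with \<open>X\<^sub>0, \<dots>, X\<^sub>\<tau>\<close>. To have runs
  of different length in one measurable space, the path is continued up to time \<open>T\<close> by \<open>X\<^sub>\<tau>\<close>.
\<close>

definition run_space :: "ew_input \<Rightarrow> (nat \<times> (nat \<times> nat \<Rightarrow> real)) measure" where
  "run_space I = count_space UNIV \<Otimes>\<^sub>M (\<Pi>\<^sub>M p\<in>{..iters I} \<times> {..<dim I}. borel)"

definition run_of ::
  "ew_input \<Rightarrow> nat \<Rightarrow> (nat \<Rightarrow> nat \<Rightarrow> real) \<Rightarrow> nat \<times> (nat \<times> nat \<Rightarrow> real)" where
  "run_of I \<tau> X = (\<tau>, \<lambda>(t, i)\<in>{..iters I} \<times> {..<dim I}. X (min t \<tau>) i)"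

definition edge_walk_law ::
  "ew_input \<Rightarrow> (nat \<Rightarrow> real) set \<Rightarrow> (nat \<times> (nat \<times> nat \<Rightarrow> real)) measure" where
  "edge_walk_law I S =
     distr (\<Pi>\<^sub>M p\<in>UNIV. std_normal_distribution) (run_space I)
       (\<lambda>g. run_of I (completed I S g) (walk I g))"


section \<open>A real RAM with normal samples\<close>

text \<open>
  Programs use natural-number variables for counting and indexing, and two-dimensional real
  arrays. Real constants are integers, there are no real operations besides the four
  arithmetic ones and comparison, and no conversions between naturals and reals.
  Every arithmetic operation, comparison, memory access, sample and control step costs 1.
\<close>

type_synonym name = string

datatype nexp = NConst nat | NVar name | NAdd nexp nexp | NSub nexp nexp

datatype rexp = RConst int | RGet name nexp nexp
  | RAdd rexp rexp | RSub rexp rexp | RMul rexp rexp | RDiv rexp rexp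

datatype bexp = NLess nexp nexp | RLess rexp rexp | BNot bexp | BAnd bexp bexp

datatype com = Skip
  | NAssign name nexp
  | RAssign name nexp nexp rexp
  | Sample name nexp nexp
  | Seq com com
  | Cond bexp com com
  | While bexp com

record store =
  nvar :: "name \<Rightarrow> nat"
  arr :: "name \<Rightarrow> nat \<Rightarrow> nat \<Rightarrow> real"
  drawn :: nat                      \<comment> \<open>number of samples used so far\<close>

primrec nval :: "nexp \<Rightarrow> store \<Rightarrow> nat" where
  "nval (NConst k) s = k"
| "nval (NVar x) s = nvar s x"
| "nval (NAdd a b) s = nval a s + nval b s"
| "nval (NSub a b) s = nval a s - nval b s"

primrec ncost :: "nexp \<Rightarrow> nat" where
  "ncost (NConst k) = 1"
| "ncost (NVar x) = 1"
| "ncost (NAdd a b) = 1 + ncost a + ncost b"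
| "ncost (NSub a b) = 1 + ncost a + ncost b"

primrec rval :: "rexp \<Rightarrow> store \<Rightarrow> real" where
  "rval (RConst z) s = of_int z"
| "rval (RGet x a b) s = arr s x (nval a s) (nval b s)"
| "rval (RAdd a b) s = rval a s + rval b s"
| "rval (RSub a b) s = rval a s - rval b s"
| "rval (RMul a b) s = rval a s * rval b s"
| "rval (RDiv a b) s = rval a s / rval b s"

primrec rcost :: "rexp \<Rightarrow> nat" where
  "rcost (RConst z) = 1"
| "rcost (RGet x a b) = 1 + ncost a + ncost b"
| "rcost (RAdd a b) = 1 + rcost a + rcost b"
| "rcost (RSub a b) = 1 + rcost a + rcost b"
| "rcost (RMul a b) = 1 + rcost a + rcost b"
| "rcost (RDiv a b) = 1 + rcost a + rcost b"

primrec bval :: "bexp \<Rightarrow> store \<Rightarrow> bool" where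
  "bval (NLess a b) s \<longleftrightarrow> nval a s < nval b s"
| "bval (RLess a b) s \<longleftrightarrow> rval a s < rval b s"
| "bval (BNot a) s \<longleftrightarrow> \<not> bval a s"
| "bval (BAnd a b) s \<longleftrightarrow> bval a s \<and> bval b s"

primrec bcost :: "bexp \<Rightarrow> nat" where
  "bcost (NLess a b) = 1 + ncost a + ncost b"
| "bcost (RLess a b) = 1 + rcost a + rcost b"
| "bcost (BNot a) = 1 + bcost a"
| "bcost (BAnd a b) = 1 + bcost a + bcost b"

definition set_nvar :: "name \<Rightarrow> nat \<Rightarrow> store \<Rightarrow> store" where
  "set_nvar x k s = s\<lparr>nvar := (nvar s)(x := k)\<rparr>"

definition set_arr :: "name \<Rightarrow> nat \<Rightarrow> nat \<Rightarrow> real \<Rightarrow> store \<Rightarrow> store" where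
  "set_arr x i j r s = s\<lparr>arr := (arr s)(x := (arr s x)(i := (arr s x i)(j := r)))\<rparr>"

text \<open>\<open>exec \<omega> c s k s'\<close>: when the successive samples are \<open>\<omega> 0, \<omega> 1, \<dots>\<close>, the program \<open>c\<close>
  started in \<open>s\<close> terminates in \<open>s'\<close> after time \<open>k\<close>.\<close>

inductive exec :: "(nat \<Rightarrow> real) \<Rightarrow> com \<Rightarrow> store \<Rightarrow> nat \<Rightarrow> store \<Rightarrow> bool" for \<omega> where
  Skip: "exec \<omega> Skip s 1 s"
| NAssign: "exec \<omega> (NAssign x a) s (1 + ncost a) (set_nvar x (nval a s) s)"
| RAssign: "exec \<omega> (RAssign x a b e) s (1 + ncost a + ncost b + rcost e)
              (set_arr x (nval a s) (nval b s) (rval e s) s)"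
| Sample: "exec \<omega> (Sample x a b) s (1 + ncost a + ncost b)
             ((set_arr x (nval a s) (nval b s) (\<omega> (drawn s)) s)\<lparr>drawn := Suc (drawn s)\<rparr>)"
| Seq: "exec \<omega> c s k s' \<Longrightarrow> exec \<omega> d s' l s'' \<Longrightarrow> exec \<omega> (Seq c d) s (k + l) s''"
| CondTrue: "bval b s \<Longrightarrow> exec \<omega> c s k s' \<Longrightarrow> exec \<omega> (Cond b c d) s (1 + bcost b + k) s'"
| CondFalse: "\<not> bval b s \<Longrightarrow> exec \<omega> d s k s' \<Longrightarrow> exec \<omega> (Cond b c d) s (1 + bcost b + k) s'"
| WhileFalse: "\<not> bval b s \<Longrightarrow> exec \<omega> (While b c) s (1 + bcost b) s"
| WhileTrue: "bval b s \<Longrightarrow> exec \<omega> c s k s' \<Longrightarrow> exec \<omega> (While b c) s' l s'' \<Longrightarrow>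
                exec \<omega> (While b c) s (1 + bcost b + k + l) s''"

inductive_cases exec_SkipE: "exec \<omega> Skip s k s'"
inductive_cases exec_NAssignE: "exec \<omega> (NAssign x a) s k s'"
inductive_cases exec_RAssignE: "exec \<omega> (RAssign x a b e) s k s'"
inductive_cases exec_SampleE: "exec \<omega> (Sample x a b) s k s'"
inductive_cases exec_SeqE: "exec \<omega> (Seq c d) s k s'"
inductive_cases exec_CondE: "exec \<omega> (Cond b c d) s k s'"
inductive_cases exec_WhileE: "exec \<omega> (While b c) s k s'"

lemma exec_deterministic:
  "exec \<omega> c s k s' \<Longrightarrow> exec \<omega> c s l s'' \<Longrightarrow> k = l \<and> s' = s''"
proof (induction arbitrary: l s'' rule: exec.induct)
  case (Skip s)
  from Skip.prems show ?case by (rule exec_SkipE) simp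
next
  case (NAssign x a s)
  from NAssign.prems show ?case by (rule exec_NAssignE) simp
next
  case (RAssign x a b e s)
  from RAssign.prems show ?case by (rule exec_RAssignE) simp
next
  case (Sample x a b s)
  from Sample.prems show ?case by (rule exec_SampleE) simp
next
  case (Seq c s k s' d k' s2)
  from Seq.prems show ?case by (rule exec_SeqE) (auto dest: Seq.IH)
next
  case (CondTrue b s c k s' d)
  from CondTrue.prems CondTrue.hyps(1) show ?case by (elim exec_CondE) (auto dest: CondTrue.IH)
next
  case (CondFalse b s d k s' c)
  from CondFalse.prems CondFalse.hyps(1) show ?case by (elim exec_CondE) (auto dest: CondFalse.IH)
next
  case (WhileFalse b s c)
  from WhileFalse.prems show ?case by (rule exec_WhileE) (simp_all add: WhileFalse.hyps)
next
  case (WhileTrue b s c k s' k' s2)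
  from WhileTrue.prems show ?case
    by (rule exec_WhileE) (simp_all add: WhileTrue.hyps(1), auto dest: WhileTrue.IH)
qed

text \<open>The input is in memory at the start, everything else is zero.\<close>

definition init_store :: "ew_input \<Rightarrow> store" where
  "init_store I =
     \<lparr>nvar = (\<lambda>_. 0)(''n'' := dim I, ''m'' := num I, ''T'' := iters I),
      arr = (\<lambda>_ _ _. 0)(
        ''v'' := \<lambda>j i. if j < num I \<and> i < dim I then vec I j i else 0,
        ''c'' := \<lambda>a j. if a = 0 \<and> j < num I then thr I j else 0,
        ''x'' := \<lambda>a i. if a = 0 \<and> i < dim I then start I i else 0,
        ''delta'' := \<lambda>a b. if a = 0 \<and> b = 0 then slack I else 0,
        ''gamma'' := \<lambda>a b. if a = 0 \<and> b = 0 then stepsize I else 0),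
      drawn = 0\<rparr>"

text \<open>The output is the number of completed iterations and the points visited, one per row.\<close>

definition output_run :: "ew_input \<Rightarrow> store \<Rightarrow> nat \<times> (nat \<times> nat \<Rightarrow> real)" where
  "output_run I s = run_of I (nvar s ''tau'') (arr s ''X'')"

definition sample_space :: "(nat \<Rightarrow> real) measure" where
  "sample_space = (\<Pi>\<^sub>M k\<in>UNIV. std_normal_distribution)"

text \<open>
  \<open>p\<close> implements Edge-Walk on input \<open>I\<close> in time \<open>B\<close>: it halts within time \<open>B\<close> whatever
  the samples are, and its output has the law of an Edge-Walk run.
\<close>

definition implements_edge_walk :: "com \<Rightarrow> ew_input \<Rightarrow> nat \<Rightarrow> bool" where
  "implements_edge_walk p I B \<longleftrightarrow>
     (\<exists>fin. (\<forall>\<omega>. \<exists>k\<le>B. exec \<omega> p (init_store I) k (fin \<omega>)) \<and>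
        (\<lambda>\<omega>. output_run I (fin \<omega>)) \<in> sample_space \<rightarrow>\<^sub>M run_space I \<and>
        (\<exists>S. failure_rule I S \<and>
           distr sample_space (run_space I) (\<lambda>\<omega>. output_run I (fin \<omega>)) = edge_walk_law I S))"

end

theory Submission
  imports Defs
begin

text \<open>
  The machine has no square roots, so no orthonormal basis can be computed. But the orthogonal
  projection of a standard Gaussian vector of \<open>\<real>\<^sup>n\<close> onto a subspace is a standard Gaussian vector in that
  subspace, because a product of Householder reflections, each of which preserves the Gaussian
  measure, maps any orthonormal family to an initial segment of the standard basis. The projection
  only needs an orthogonal, not normalised, basis of the orthogonal complement.

  Each step is orthogonal to the tight constraints, so a tight constraint stays tight, and that
  basis can be extended by Gram-Schmidt as constraints become tight. If the procedure fails
  as soon as \<open>n\<close> discrepancy constraints are tight, there are at most \<open>2n\<close> extensions, each of cost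
  \<open>O(n\<^sup>2)\<close>; finding the tight constraints costs \<open>O((m + n) n)\<close> per iteration and projecting \<open>O(n\<^sup>2)\<close>.
\<close>

section \<open>Orthonormal bases and projections\<close>

text \<open>The output agrees with Edge-Walk only in law, not sample by sample: the definition feeds
  one normal per vector of an unspecified orthonormal basis of V_t, while the program spends n
  samples in every iteration and projects. The obstacle is that V_t depends on the earlier samples,
  so equality in law for a fixed subspace does not by itself give equality in law of whole paths. It
  is lifted one step at a time: by Fubini, the law of a longer path is the law of the shorter one
  followed by a Gaussian step in a subspace that the shorter path determines. The time bound leaves
  no room for rebuilding a basis in each iteration, which would cost order T n^3 in total; hence the
  amortisation. A constraint that depends linearly on earlier ones yields a zero row. Such rows are
  kept, so rows count constraints rather than dimensions, and 2n takes the place of n.\<close>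

lemma ip_commute: "ip n u w = ip n w u"
  by (simp add: ip_def mult.commute)

lemma ip_cong:
  "\<lbrakk>\<And>i. i < n \<Longrightarrow> u i = u' i; \<And>i. i < n \<Longrightarrow> w i = w' i\<rbrakk> \<Longrightarrow> ip n u w = ip n u' w'"
  by (simp add: ip_def)

lemma ip_add_left: "ip n (\<lambda>i. u i + w i) z = ip n u z + ip n w z"
  by (simp add: ip_def algebra_simps sum.distrib)

lemma ip_diff_left: "ip n (\<lambda>i. u i - w i) z = ip n u z - ip n w z"
  by (simp add: ip_def algebra_simps sum_subtractf)

lemma ip_scale_left: "ip n (\<lambda>i. c * u i) z = c * ip n u z"
  by (simp add: ip_def sum_distrib_left mult.assoc)

lemma ip_lincomb_left: "ip n (\<lambda>i. \<Sum>k\<in>A. a k * f k i) z = (\<Sum>k\<in>A. a k * ip n (f k) z)"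
proof -
  have "ip n (\<lambda>i. \<Sum>k\<in>A. a k * f k i) z = (\<Sum>i<n. \<Sum>k\<in>A. a k * (f k i * z i))"
    by (simp add: ip_def sum_distrib_right mult.assoc)
  also have "\<dots> = (\<Sum>k\<in>A. \<Sum>i<n. a k * (f k i * z i))"
    by (rule sum.swap)
  finally show ?thesis by (simp add: ip_def sum_distrib_left)
qed

lemmas ip_left = ip_add_left ip_diff_left ip_scale_left ip_lincomb_left

lemma ip_right:
  "ip n z (\<lambda>i. u i + w i) = ip n z u + ip n z w"
  "ip n z (\<lambda>i. u i - w i) = ip n z u - ip n z w"
  "ip n z (\<lambda>i. c * u i) = c * ip n z u"
  "ip n z (\<lambda>i. \<Sum>k\<in>A. a k * f k i) = (\<Sum>k\<in>A. a k * ip n z (f k))"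
  by (simp_all add: ip_commute[of n z] ip_left)

lemma ip_self_nonneg: "ip n u u \<ge> 0"
  by (simp add: ip_def sum_nonneg)

lemma ip_self_eq_0_iff: "ip n u u = 0 \<longleftrightarrow> (\<forall>i<n. u i = 0)"
  by (subst ip_def, subst sum_nonneg_eq_0_iff) auto

section \<open>Orthonormal families and Bessel's inequality\<close>

definition unit_vec :: "nat \<Rightarrow> nat \<Rightarrow> real" where
  "unit_vec k i = (if i = k then 1 else 0)"

lemma ip_unit_vec:
  assumes "k < n"
  shows "ip n u (unit_vec k) = u k" "ip n (unit_vec k) u = u k"
proof -
  have "u i * unit_vec k i = (if i = k then u i else 0)" for i
    by (simp add: unit_vec_def)
  then show "ip n u (unit_vec k) = u k" using assms by (simp add: ip_def)
  then show "ip n (unit_vec k) u = u k" by (subst ip_commute)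
qed

definition orthonormal :: "nat \<Rightarrow> (nat \<Rightarrow> real) list \<Rightarrow> bool" where
  "orthonormal n ws \<longleftrightarrow>
     (\<forall>k<length ws. \<forall>l<length ws. ip n (ws ! k) (ws ! l) = (if k = l then 1 else 0))"

lemma orthonormalD:
  "\<lbrakk>orthonormal n ws; k < length ws; l < length ws\<rbrakk> \<Longrightarrow> ip n (ws ! k) (ws ! l) = (if k = l then 1 else 0)"
  by (simp add: orthonormal_def)

lemma ip_lincomb_orthonormal:
  assumes "orthonormal n ws" "l < length ws"
  shows "ip n (\<lambda>i. \<Sum>k<length ws. a k * (ws ! k) i) (ws ! l) = a l"
proof -
  have "ip n (\<lambda>i. \<Sum>k<length ws. a k * (ws ! k) i) (ws ! l)
      = (\<Sum>k<length ws. if k = l then a k else 0)"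
    unfolding ip_lincomb_left by (rule sum.cong) (use assms in \<open>auto simp: orthonormalD\<close>)
  then show ?thesis using assms(2) by simp
qed

definition residual :: "nat \<Rightarrow> (nat \<Rightarrow> real) list \<Rightarrow> (nat \<Rightarrow> real) \<Rightarrow> nat \<Rightarrow> real" where
  "residual n ws u = (\<lambda>i. u i - (\<Sum>k<length ws. ip n u (ws ! k) * (ws ! k) i))"

lemma ip_residual:
  "\<lbrakk>orthonormal n ws; l < length ws\<rbrakk> \<Longrightarrow> ip n (residual n ws u) (ws ! l) = 0"
  by (simp add: residual_def ip_diff_left ip_lincomb_orthonormal)

lemma ip_residual_self:
  assumes "orthonormal n ws"
  shows "ip n (residual n ws u) (residual n ws u) = ip n u u - (\<Sum>k<length ws. (ip n u (ws ! k))\<^sup>2)"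
proof -
  have "ip n (residual n ws u) (residual n ws u) = ip n (residual n ws u) u"
    by (subst (2) residual_def) (simp add: ip_right ip_residual[OF assms])
  also have "\<dots> = ip n u (residual n ws u)" by (rule ip_commute)
  also have "\<dots> = ip n u u - (\<Sum>k<length ws. ip n u (ws ! k) * ip n u (ws ! k))"
    unfolding residual_def ip_right ..
  finally show ?thesis
    by (simp add: power2_eq_square)
qed

lemma bessel: "orthonormal n ws \<Longrightarrow> (\<Sum>k<length ws. (ip n u (ws ! k))\<^sup>2) \<le> ip n u u"
  using ip_self_nonneg[of n "residual n ws u"] by (simp add: ip_residual_self)

text \<open>Double counting of the squared coordinates of all vectors: each vector of
  \<open>ws\<close> contributes 1 in total, and by Bessel's inequality for a standard basis vector
  each of the \<open>n\<close> coordinates contributes at most 1.\<close>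

lemma length_orthonormal_le:
  assumes "orthonormal n ws"
  shows "length ws \<le> n"
proof -
  have "real (length ws) = (\<Sum>k<length ws. \<Sum>i<n. (ip n (unit_vec i) (ws ! k))\<^sup>2)"
    using orthonormalD[OF assms] by (simp add: ip_unit_vec power2_eq_square) (simp add: ip_def)
  also have "\<dots> = (\<Sum>i<n. \<Sum>k<length ws. (ip n (unit_vec i) (ws ! k))\<^sup>2)"
    by (rule sum.swap)
  also have "\<dots> \<le> (\<Sum>i<n. ip n (unit_vec i) (unit_vec i))"
    by (intro sum_mono bessel assms)
  also have "\<dots> = real n" by (simp add: ip_unit_vec) (simp add: unit_vec_def)
  finally show ?thesis by simp
qed

section \<open>Subspaces, their orthonormal bases and orthogonal projections\<close>

definition lin_subspace :: "nat \<Rightarrow> (nat \<Rightarrow> real) set \<Rightarrow> bool" where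
  "lin_subspace n V \<longleftrightarrow>
     (\<lambda>i. 0) \<in> V \<and> (\<forall>u\<in>V. \<forall>w\<in>V. (\<lambda>i. u i + w i) \<in> V) \<and> (\<forall>c. \<forall>u\<in>V. (\<lambda>i. c * u i) \<in> V) \<and>
     (\<forall>u\<in>V. \<forall>i\<ge>n. u i = 0)"

lemma lin_subspace_lincomb:
  assumes "lin_subspace n V" "\<And>k. k < d \<Longrightarrow> f k \<in> V"
  shows "(\<lambda>i. \<Sum>k<(d::nat). a k * f k i) \<in> V"
  using assms(2)
proof (induction d)
  case 0
  then show ?case using assms(1) by (simp add: lin_subspace_def)
next
  case (Suc d)
  then have "(\<lambda>i. \<Sum>k<d. a k * f k i) \<in> V" "(\<lambda>i. a d * f d i) \<in> V"
    using assms(1) by (simp_all add: lin_subspace_def)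
  then show ?case using assms(1) by (simp add: lin_subspace_def)
qed

lemma residual_in_subspace:
  assumes V: "lin_subspace n V" and "set ws \<subseteq> V" "u \<in> V"
  shows "residual n ws u \<in> V"
proof -
  have "(\<lambda>i. \<Sum>k<length ws. - ip n u (ws ! k) * (ws ! k) i) \<in> V"
    by (rule lin_subspace_lincomb[OF V]) (use assms in auto)
  then have "(\<lambda>i. u i + (\<Sum>k<length ws. - ip n u (ws ! k) * (ws ! k) i)) \<in> V"
    using V assms(3) by (simp add: lin_subspace_def)
  then show ?thesis by (simp add: residual_def sum_negf)
qed

lemma orthonormal_snoc:
  assumes "orthonormal n ws" "ip n r r = 1" "\<And>l. l < length ws \<Longrightarrow> ip n r (ws ! l) = 0"
  shows "orthonormal n (ws @ [r])"
proof -
  have "ip n (ws ! l) r = 0" if "l < length ws" for l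
    using assms(3)[OF that] by (subst ip_commute)
  then show ?thesis
    using assms by (auto simp: orthonormal_def nth_append less_Suc_eq)
qed

text \<open>An orthonormal list in \<open>V\<close> of maximal length spans \<open>V\<close>,
  because a nonzero residual could be normalised and appended. This gives the choice in
  \<open>gaussian_in\<close> a genuine witness.\<close>

lemma orthonormal_basis_exists:
  assumes V: "lin_subspace n V"
  shows "\<exists>ws. orthonormal_basis n V ws"
proof -
  let ?P = "\<lambda>ws. set ws \<subseteq> V \<and> orthonormal n ws"
  obtain ws where ws: "?P ws" and max: "\<And>ws'. ?P ws' \<Longrightarrow> length ws' \<le> length ws"
    using ex_has_greatest_nat[of ?P "[]" length "Suc n"] length_orthonormal_le
    by (auto simp: orthonormal_def le_imp_less_Suc)
  have "\<exists>a. u = (\<lambda>i. \<Sum>k<length ws. a k * (ws ! k) i)" if u: "u \<in> V" for u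
  proof -
    let ?r = "residual n ws u"
    have rV: "?r \<in> V" using residual_in_subspace[OF V] ws u by blast
    have "ip n ?r ?r = 0"
    proof (rule ccontr)
      assume ne: "ip n ?r ?r \<noteq> 0"
      let ?w = "\<lambda>i. 1 / sqrt (ip n ?r ?r) * ?r i"
      have "ip n ?w ?w = 1"
        using ne ip_self_nonneg[of n ?r] by (simp only: ip_left ip_right) simp
      moreover have "?w \<in> V" using rV V unfolding lin_subspace_def by blast
      moreover have "ip n ?w (ws ! l) = 0" if "l < length ws" for l
        unfolding ip_left using ip_residual ws that by simp
      ultimately have "?P (ws @ [?w])"
        using ws by (intro conjI orthonormal_snoc) auto
      from max[OF this] show False by simp
    qed
    then have "?r i = 0" for i
      using rV V by (cases "i < n") (auto simp: ip_self_eq_0_iff lin_subspace_def)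
    then have "u = (\<lambda>i. \<Sum>k<length ws. ip n u (ws ! k) * (ws ! k) i)"
      by (auto simp: residual_def fun_eq_iff)
    then show ?thesis by (rule exI[of _ "\<lambda>k. ip n u (ws ! k)"])
  qed
  then show ?thesis using ws unfolding orthonormal_basis_def orthonormal_def by blast
qed

text \<open>A name for the very basis that \<open>gaussian_in\<close> chooses.\<close>

definition onb :: "nat \<Rightarrow> (nat \<Rightarrow> real) set \<Rightarrow> (nat \<Rightarrow> real) list" where
  "onb n V = (SOME ws. orthonormal_basis n V ws)"

lemma orthonormal_basis_onb: "lin_subspace n V \<Longrightarrow> orthonormal_basis n V (onb n V)"
  unfolding onb_def using orthonormal_basis_exists by (rule someI_ex)

lemma gaussian_in_eq: "gaussian_in n V g = (\<lambda>i. \<Sum>k<length (onb n V). g k * (onb n V ! k) i)"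
  by (simp add: gaussian_in_def onb_def Let_def)

text \<open>With the inner products of \<open>g\<close> and the basis vectors as coefficients,
  \<open>gaussian_in\<close> becomes the orthogonal projection onto \<open>V\<close>. In this form,
  comparing the two laws only means comparing two coefficient vectors.\<close>

definition proj :: "nat \<Rightarrow> (nat \<Rightarrow> real) set \<Rightarrow> (nat \<Rightarrow> real) \<Rightarrow> nat \<Rightarrow> real" where
  "proj n V g = gaussian_in n V (\<lambda>k. ip n g (onb n V ! k))"

text \<open>The characterisation by which the vector computed by the program is recognised: the
  program works with a basis of the orthogonal complement and never sees \<open>onb\<close>.\<close>

lemma proj_unique:
  assumes V: "lin_subspace n V" and u: "u \<in> V"
    and orth: "\<And>w. w \<in> V \<Longrightarrow> ip n (\<lambda>i. g i - u i) w = 0"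
  shows "proj n V g = u"
proof -
  have B: "orthonormal_basis n V (onb n V)" using V by (rule orthonormal_basis_onb)
  then have on: "orthonormal n (onb n V)" and sub: "set (onb n V) \<subseteq> V"
    by (simp_all add: orthonormal_basis_def orthonormal_def)
  obtain a where a: "u = (\<lambda>i. \<Sum>k<length (onb n V). a k * (onb n V ! k) i)"
    using B u unfolding orthonormal_basis_def by blast
  have "ip n g (onb n V ! k) = a k" if k: "k < length (onb n V)" for k
  proof -
    have "ip n g (onb n V ! k) = ip n u (onb n V ! k)"
      using orth[of "onb n V ! k"] subsetD[OF sub nth_mem[OF k]] by (simp add: ip_left)
    also have "\<dots> = a k" using ip_lincomb_orthonormal[OF on k, of a] a by simp
    finally show ?thesis .
  qed
  then show ?thesis by (simp add: proj_def gaussian_in_eq a)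
qed

lemma gaussian_in_mem:
  assumes V: "lin_subspace n V"
  shows "gaussian_in n V g \<in> V"
proof -
  have "onb n V ! k \<in> V" if "k < length (onb n V)" for k
    using orthonormal_basis_onb[OF V] nth_mem[OF that] by (auto simp: orthonormal_basis_def)
  then show ?thesis
    unfolding gaussian_in_eq by (rule lin_subspace_lincomb[OF V, of _ "\<lambda>k. onb n V ! k"])
qed

lemma lin_subspace_V_space: "lin_subspace (dim I) (V_space I x)"
  unfolding lin_subspace_def V_space_def
  by (simp add: ip_add_left ip_scale_left) (simp add: ip_def)

section \<open>Rotation invariance of the Gaussian measure\<close>

abbreviation lborel_n :: "nat \<Rightarrow> (nat \<Rightarrow> real) measure" where
  "lborel_n n \<equiv> \<Pi>\<^sub>M i\<in>{..<n}. lborel"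

abbreviation gauss_n :: "nat \<Rightarrow> (nat \<Rightarrow> real) measure" where
  "gauss_n n \<equiv> \<Pi>\<^sub>M i\<in>{..<n}. std_normal_distribution"

interpretation lborel_prod: product_sigma_finite "\<lambda>_::'i. lborel :: real measure"
  by standard

lemma prob_space_std_normal: "prob_space std_normal_distribution"
  by (rule prob_space_normal_density) simp

interpretation gauss_prod: product_sigma_finite "\<lambda>_::'i. std_normal_distribution"
  by (intro product_sigma_finite.intro prob_space_imp_sigma_finite prob_space_std_normal)

text \<open>Both sides agree on boxes, which determine a product measure.\<close>

lemma gauss_n_eq_density:
  "gauss_n n = density (lborel_n n) (\<lambda>x. \<Prod>i<n. ennreal (std_normal_density (x i)))"
proof (rule gauss_prod.PiM_eqI[symmetric])
  show "sets (density (lborel_n n) (\<lambda>x. \<Prod>i<n. ennreal (std_normal_density (x i)))) = sets (gauss_n n)"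
    by (simp cong: sets_PiM_cong)
next
  fix A :: "nat \<Rightarrow> real set"
  assume A: "\<And>i. i \<in> {..<n} \<Longrightarrow> A i \<in> sets std_normal_distribution"
  have "emeasure (density (lborel_n n) (\<lambda>x. \<Prod>i<n. ennreal (std_normal_density (x i)))) (Pi\<^sub>E {..<n} A)
      = (\<integral>\<^sup>+x. (\<Prod>i<n. ennreal (std_normal_density (x i))) * indicator (Pi\<^sub>E {..<n} A) x \<partial>lborel_n n)"
    using A by (subst emeasure_density) (auto intro!: sets_PiM_I_finite)
  also have "\<dots> = (\<integral>\<^sup>+x. (\<Prod>i\<in>{..<n}. ennreal (std_normal_density (x i)) * indicator (A i) (x i)) \<partial>lborel_n n)"
    by (intro nn_integral_cong)
      (auto simp: prod.distrib indicator_def PiE_iff space_PiM extensional_def)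
  also have "\<dots> = (\<Prod>i<n. \<integral>\<^sup>+x. ennreal (std_normal_density x) * indicator (A i) x \<partial>lborel)"
    using A by (subst lborel_prod.product_nn_integral_prod
        [where f = "\<lambda>i x. ennreal (std_normal_density x) * indicator (A i) x"]) auto
  also have "\<dots> = (\<Prod>i<n. emeasure std_normal_distribution (A i))"
    using A by (intro prod.cong refl) (simp add: emeasure_density)
  finally show "emeasure (density (lborel_n n) (\<lambda>x. \<Prod>i<n. ennreal (std_normal_density (x i)))) (Pi\<^sub>E {..<n} A)
      = (\<Prod>i<n. emeasure std_normal_distribution (A i))" .
qed simp

text \<open>In this form the density visibly depends on \<open>x\<close> through its norm only, so
  every isometry leaves it unchanged.\<close>

lemma prod_std_normal_density:
  "(\<Prod>i<n. ennreal (std_normal_density (x i))) = ennreal ((1 / sqrt (2 * pi)) ^ n * exp (- ip n x x / 2))"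
proof -
  have "(\<Prod>i<n. std_normal_density (x i)) = (1 / sqrt (2 * pi)) ^ n * exp (\<Sum>i<n. - (x i)\<^sup>2 / 2)"
    by (simp add: std_normal_density_def prod.distrib exp_sum prod_dividef power_divide)
  also have "(\<Sum>i<n. - (x i)\<^sup>2 / 2) = - ip n x x / 2"
    by (simp add: ip_def power2_eq_square sum_negf sum_divide_distrib)
  finally show ?thesis by (simp add: prod_ennreal)
qed

lemma measurable_ip[measurable]:
  "\<lbrakk>\<And>i. i < n \<Longrightarrow> (\<lambda>x. f x i) \<in> borel_measurable M; \<And>i. i < n \<Longrightarrow> (\<lambda>x. g x i) \<in> borel_measurable M\<rbrakk>
   \<Longrightarrow> (\<lambda>x. ip n (f x) (g x)) \<in> borel_measurable M"
  unfolding ip_def by (intro borel_measurable_sum borel_measurable_times) auto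

text \<open>Fubini with coordinate \<open>p\<close> innermost: \<open>f\<close> does not see that
  coordinate, so the inner integral undergoes a one-dimensional affine substitution with factor
  \<bar>a\<bar>. Shears are the case \<open>a = 1\<close>.\<close>

lemma nn_integral_update_affine:
  assumes p: "p < n" and a: "a \<noteq> (0::real)"
    and [measurable]: "f \<in> borel_measurable (lborel_n n)" "h \<in> borel_measurable (lborel_n n)"
    and f: "\<And>x y. f (x(p := y)) = f x"
  shows "(\<integral>\<^sup>+x. h x \<partial>lborel_n n) = ennreal \<bar>a\<bar> * (\<integral>\<^sup>+x. h (x(p := f x + a * x p)) \<partial>lborel_n n)"
proof -
  define J where "J = {..<n} - {p}"
  have J: "{..<n} = insert p J" "finite J" "p \<notin> J" using p by (auto simp: J_def)
  have [measurable]: "f \<in> borel_measurable (Pi\<^sub>M (insert p J) (\<lambda>_. lborel))"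
    "h \<in> borel_measurable (Pi\<^sub>M (insert p J) (\<lambda>_. lborel))"
    using assms(3,4) by (simp_all add: J(1))
  have upd[measurable]: "(\<lambda>x. x(p := f x + a * x p))
      \<in> Pi\<^sub>M (insert p J) (\<lambda>_. lborel) \<rightarrow>\<^sub>M Pi\<^sub>M (insert p J) (\<lambda>_. lborel)"
    by (rule measurable_fun_upd[of _ "insert p J"]) auto
  have "(\<integral>\<^sup>+x. h x \<partial>lborel_n n) = (\<integral>\<^sup>+x. (\<integral>\<^sup>+y. h (x(p := y)) \<partial>lborel) \<partial>Pi\<^sub>M J (\<lambda>_. lborel))"
    unfolding J(1) using J by (intro lborel_prod.product_nn_integral_insert) auto
  also have "\<dots> = (\<integral>\<^sup>+x. ennreal \<bar>a\<bar> * (\<integral>\<^sup>+y. h (x(p := f x + a * y)) \<partial>lborel) \<partial>Pi\<^sub>M J (\<lambda>_. lborel))"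
  proof (rule nn_integral_cong)
    fix x assume x: "x \<in> space (Pi\<^sub>M J (\<lambda>_. lborel :: real measure))"
    have "(\<lambda>y. h (x(p := y))) \<in> borel_measurable lborel"
      using measurable_comp[OF measurable_component_update[OF x J(3)], of h borel] by (simp add: comp_def)
    then show "(\<integral>\<^sup>+y. h (x(p := y)) \<partial>lborel) = ennreal \<bar>a\<bar> * (\<integral>\<^sup>+y. h (x(p := f x + a * y)) \<partial>lborel)"
      using nn_integral_real_affine[OF _ a, of "\<lambda>y. h (x(p := y))" "f x"] by simp
  qed
  also have "\<dots> = (\<integral>\<^sup>+x. (\<integral>\<^sup>+y. ennreal \<bar>a\<bar> * h (x(p := f x + a * y)) \<partial>lborel) \<partial>Pi\<^sub>M J (\<lambda>_. lborel))"
  proof (rule nn_integral_cong)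
    fix x assume x: "x \<in> space (Pi\<^sub>M J (\<lambda>_. lborel :: real measure))"
    have "(\<lambda>y. h (x(p := y))) \<in> borel_measurable lborel"
      using measurable_comp[OF measurable_component_update[OF x J(3)], of h borel] by (simp add: comp_def)
    then have "(\<lambda>y. h (x(p := f x + a * y))) \<in> borel_measurable lborel"
      by (rule measurable_compose[rotated]) simp
    then show "ennreal \<bar>a\<bar> * (\<integral>\<^sup>+y. h (x(p := f x + a * y)) \<partial>lborel)
        = (\<integral>\<^sup>+y. ennreal \<bar>a\<bar> * h (x(p := f x + a * y)) \<partial>lborel)"
      by (rule nn_integral_cmult[symmetric])
  qed
  also have "\<dots> = (\<integral>\<^sup>+x. ennreal \<bar>a\<bar> * h (x(p := f x + a * x p)) \<partial>lborel_n n)"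
    unfolding J(1) using J by (subst lborel_prod.product_nn_integral_insert) (auto simp: f)
  also have "\<dots> = ennreal \<bar>a\<bar> * (\<integral>\<^sup>+x. h (x(p := f x + a * x p)) \<partial>lborel_n n)"
    unfolding J(1) by (intro nn_integral_cmult) measurable
  finally show ?thesis .
qed

text \<open>The reflection in the hyperplane orthogonal to \<open>v\<close>, and the identity on the
  coordinates below \<open>n\<close> if \<open>v\<close> vanishes there, because division by zero
  gives zero. The restriction keeps the result in the product space, whose points are extensional
  functions.\<close>

definition householder :: "nat \<Rightarrow> (nat \<Rightarrow> real) \<Rightarrow> (nat \<Rightarrow> real) \<Rightarrow> nat \<Rightarrow> real" where
  "householder n v x = (\<lambda>i\<in>{..<n}. x i - 2 * ip n x v / ip n v v * v i)"

lemma householder_measurable[measurable]: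
  "householder n v \<in> (\<Pi>\<^sub>M i\<in>{..<n}. borel) \<rightarrow>\<^sub>M (\<Pi>\<^sub>M i\<in>{..<n}. borel)"
  unfolding householder_def by (rule measurable_restrict) measurable

lemma ip_householder: "ip n (householder n v x) (householder n v y) = ip n x y"
proof -
  have "ip n (householder n v x) (householder n v y)
      = ip n (\<lambda>i. x i - (2 * ip n x v / ip n v v) * v i) (\<lambda>i. y i - (2 * ip n y v / ip n v v) * v i)"
    by (rule ip_cong) (simp_all add: householder_def)
  also have "\<dots> = ip n x y"
    by (cases "ip n v v = 0")
      (simp_all only: ip_left ip_right, simp_all add: ip_commute[of n v y] field_simps)
  finally show ?thesis .
qed

text \<open>A shear-and-scale of the coordinate \<open>p\<close> turns \<open>x p\<close> into \<open>ip n x v\<close>; in these coordinates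
  the reflection adds multiples of coordinate \<open>p\<close> to the other ones and then negates it.\<close>

lemma nn_integral_householder:
  assumes h: "h \<in> borel_measurable (lborel_n n)"
  shows "(\<integral>\<^sup>+x. h (householder n v x) \<partial>lborel_n n) = (\<integral>\<^sup>+x. h x \<partial>lborel_n n)"
proof (cases "\<forall>i<n. v i = 0")
  case True
  have "householder n v x = x" if "x \<in> space (lborel_n n)" for x
    using that True by (auto simp: householder_def fun_eq_iff space_PiM PiE_def extensional_def)
  then show ?thesis by (simp cong: nn_integral_cong)
next
  case False
  then obtain p where p: "p < n" "v p \<noteq> 0" by auto
  define s where "s = ip n v v"
  have s: "s \<noteq> 0" using p by (auto simp: s_def ip_self_eq_0_iff)
  define tail where "tail x = (\<Sum>i\<in>{..<n} - {p}. v i * x i)" for x :: "nat \<Rightarrow> real"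
  have ip_tail: "ip n x v = v p * x p + tail x" for x
    unfolding ip_def tail_def using p(1) by (subst sum.remove[of _ p]) (auto simp: mult.commute)
  have tail_upd: "tail (x(p := y)) = tail x" for x y
    by (auto simp: tail_def intro!: sum.cong)
  have [measurable]: "tail \<in> borel_measurable (lborel_n n)"
    unfolding tail_def by (intro borel_measurable_sum) auto
  \<comment> \<open>The reflection is factored as \<open>U\<close> after \<open>R\<close> after
    \<open>S\<close>. Their determinants are \<open>v p\<close>, 1 and \<open>- 1 / v p\<close>, so
    the absolute values cancel. \<open>R\<close> is composed of shears of one coordinate each,
    whence the induction over \<open>J\<close> below.\<close>
  define S where "S x = x(p := tail x + v p * x p)" for x
  define R where "R J x = (\<lambda>i. if i \<in> J then x i + (- 2 * v i / s) * x p else x i)"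
    for J and x :: "nat \<Rightarrow> real"
  define U where "U x = x(p := - tail x / v p + (- 1 / v p) * x p)" for x
  have U[measurable]: "U \<in> lborel_n n \<rightarrow>\<^sub>M lborel_n n"
    unfolding U_def using p by (intro measurable_fun_upd[of _ "{..<n}"]) auto
  have R_measurable: "R J \<in> lborel_n n \<rightarrow>\<^sub>M lborel_n n" if "J \<subseteq> {..<n}" for J
  proof -
    have "(\<lambda>x. \<lambda>i\<in>{..<n}. R J x i) \<in> lborel_n n \<rightarrow>\<^sub>M lborel_n n"
      unfolding R_def using p by (intro measurable_restrict) auto
    moreover have "(\<lambda>i\<in>{..<n}. R J x i) = R J x" if "x \<in> space (lborel_n n)" for x
      using that \<open>J \<subseteq> {..<n}\<close> by (auto simp: R_def fun_eq_iff space_PiM PiE_def extensional_def)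
    ultimately show ?thesis by (simp cong: measurable_cong)
  qed
  have R: "(\<integral>\<^sup>+x. g (R J x) \<partial>lborel_n n) = (\<integral>\<^sup>+x. g x \<partial>lborel_n n)"
    if g: "g \<in> borel_measurable (lborel_n n)" and J: "J \<subseteq> {..<n} - {p}" for g J
    using finite_subset[OF J finite_Diff[OF finite_lessThan]] J
  proof (induction J rule: finite_induct)
    case empty
    then show ?case by (simp add: R_def)
  next
    case (insert j J)
    have "R (insert j J) x = R J (x(j := (- 2 * v j / s) * x p + 1 * x j))" for x
      using insert by (auto simp: R_def fun_eq_iff)
    then have "(\<integral>\<^sup>+x. g (R (insert j J) x) \<partial>lborel_n n)
        = (\<integral>\<^sup>+x. g (R J (x(j := (- 2 * v j / s) * x p + 1 * x j))) \<partial>lborel_n n)"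
      by simp
    also have "\<dots> = (\<integral>\<^sup>+x. g (R J x) \<partial>lborel_n n)"
      using insert p(1) measurable_compose[OF R_measurable g, of J]
      by (subst nn_integral_update_affine
          [where p = j and a = 1 and f = "\<lambda>x. (- 2 * v j / s) * x p" and h = "\<lambda>x. g (R J x)"]) auto
    finally show ?case using insert by auto
  qed
  have H: "householder n v x = U (R ({..<n} - {p}) (S x))" if "x \<in> space (lborel_n n)" for x
  proof
    fix i
    have Sp: "S x p = ip n x v" by (simp add: S_def ip_tail)
    let ?y = "R ({..<n} - {p}) (S x)"
    have y: "?y i = x i - 2 * ip n x v / s * v i" if "i < n" "i \<noteq> p" for i
      using that Sp by (simp add: R_def S_def field_simps)
    have yp: "?y p = ip n x v" using Sp by (simp add: R_def)
    have "tail ?y = (\<Sum>i\<in>{..<n} - {p}. v i * (x i - 2 * ip n x v / s * v i))"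
      unfolding tail_def by (rule sum.cong) (auto simp: y)
    also have "\<dots> = tail x - 2 * ip n x v / s * tail v"
      by (simp add: tail_def sum_subtractf sum_distrib_left algebra_simps)
    also have "tail v = s - v p * v p" using ip_tail[of v] by (simp add: s_def)
    finally have tl: "tail ?y = tail x - 2 * ip n x v / s * (s - v p * v p)" .
    have "v p * U ?y p = - tail ?y - ip n x v" using p(2) yp by (simp add: U_def field_simps)
    also have "\<dots> = v p * (x p - 2 * ip n x v / s * v p)"
      unfolding tl using s by (simp add: field_simps) (simp add: ip_tail algebra_simps)
    finally have Up: "U ?y p = x p - 2 * ip n x v / s * v p" using p(2) by simp
    consider "i = p" | "i < n" "i \<noteq> p" | "i \<ge> n" by linarith
    then show "householder n v x i = U ?y i"
    proof cases
      case 1 then show ?thesis using p Up by (simp add: householder_def s_def)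
    next
      case 2 then show ?thesis using y[of i] by (simp add: householder_def s_def U_def)
    next
      case 3 then show ?thesis using p that
        by (auto simp: householder_def U_def R_def S_def space_PiM PiE_def extensional_def)
    qed
  qed
  have hU[measurable]: "(\<lambda>x. h (U x)) \<in> borel_measurable (lborel_n n)"
    using U h by (rule measurable_compose)
  have hR[measurable]: "(\<lambda>x. h (U (R ({..<n} - {p}) x))) \<in> borel_measurable (lborel_n n)"
    using R_measurable hU by (rule measurable_compose) auto
  have "(\<integral>\<^sup>+x. h x \<partial>lborel_n n) = ennreal \<bar>- 1 / v p\<bar> * (\<integral>\<^sup>+x. h (U x) \<partial>lborel_n n)"
    unfolding U_def using p h
    by (intro nn_integral_update_affine) (auto simp: tail_upd)
  also have "(\<integral>\<^sup>+x. h (U x) \<partial>lborel_n n) = (\<integral>\<^sup>+x. h (U (R ({..<n} - {p}) x)) \<partial>lborel_n n)"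
    by (rule R[symmetric]) auto
  also have "\<dots> = ennreal \<bar>v p\<bar> * (\<integral>\<^sup>+x. h (U (R ({..<n} - {p}) (S x))) \<partial>lborel_n n)"
    unfolding S_def using p by (intro nn_integral_update_affine hR) (auto simp: tail_upd)
  also have "(\<integral>\<^sup>+x. h (U (R ({..<n} - {p}) (S x))) \<partial>lborel_n n) = (\<integral>\<^sup>+x. h (householder n v x) \<partial>lborel_n n)"
    by (rule nn_integral_cong) (simp add: H)
  also have "ennreal \<bar>- 1 / v p\<bar> * (ennreal \<bar>v p\<bar> * (\<integral>\<^sup>+x. h (householder n v x) \<partial>lborel_n n))
      = (\<integral>\<^sup>+x. h (householder n v x) \<partial>lborel_n n)"
    using p(2) by (simp flip: mult.assoc ennreal_mult)
  finally show ?thesis ..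
qed

section \<open>Reflections and rotations of the Gaussian measure\<close>

lemma sets_gauss: "sets (\<Pi>\<^sub>M i\<in>J. std_normal_distribution) = sets (\<Pi>\<^sub>M i\<in>J. borel)"
  by (intro sets_PiM_cong) auto

text \<open>Change of variables: a reflection is an isometry, hence preserves the density, and it
  preserves the Lebesgue integral.\<close>

lemma distr_householder: "distr (gauss_n n) (gauss_n n) (householder n v) = gauss_n n"
proof (rule measure_eqI)
  fix A assume "A \<in> sets (distr (gauss_n n) (gauss_n n) (householder n v))"
  then have A: "A \<in> sets (gauss_n n)" by simp
  have AL[measurable]: "A \<in> sets (lborel_n n)"
    using A by (simp add: sets_gauss)
  have HL[measurable]: "householder n v \<in> lborel_n n \<rightarrow>\<^sub>M lborel_n n"
    using householder_measurable[of n v] by (simp cong: measurable_cong_sets sets_PiM_cong)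
  have HG[measurable]: "householder n v \<in> gauss_n n \<rightarrow>\<^sub>M gauss_n n"
    using householder_measurable[of n v] by (simp add: measurable_cong_sets[OF sets_gauss sets_gauss])
  let ?D = "\<lambda>x. \<Prod>i<n. ennreal (std_normal_density (x i))"
  have "emeasure (distr (gauss_n n) (gauss_n n) (householder n v)) A
      = (\<integral>\<^sup>+x. indicator A (householder n v x) \<partial>gauss_n n)"
    using A by (subst nn_integral_distr[symmetric, of _ _ "gauss_n n"]) auto
  also have "\<dots> = (\<integral>\<^sup>+x. ?D x * indicator A (householder n v x) \<partial>lborel_n n)"
    unfolding gauss_n_eq_density by (rule nn_integral_density) measurable
  also have "\<dots> = (\<integral>\<^sup>+x. ?D (householder n v x) * indicator A (householder n v x) \<partial>lborel_n n)"
    by (simp add: prod_std_normal_density ip_householder)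
  also have "\<dots> = (\<integral>\<^sup>+x. ?D x * indicator A x \<partial>lborel_n n)"
    by (rule nn_integral_householder[where h = "\<lambda>x. ?D x * indicator A x"]) measurable
  also have "\<dots> = emeasure (gauss_n n) A"
    unfolding gauss_n_eq_density by (rule emeasure_density[symmetric]) auto
  finally show "emeasure (distr (gauss_n n) (gauss_n n) (householder n v)) A = emeasure (gauss_n n) A" .
qed simp

text \<open>The mirror is the perpendicular bisector of the two unit vectors.\<close>

lemma householder_swap:
  assumes "ip n u u = 1" "ip n w w = 1" "i < n"
  shows "householder n (\<lambda>i. u i - w i) u i = w i"
proof -
  let ?v = "\<lambda>i. u i - w i"
  \<comment> \<open>Since both vectors have norm 1, the coefficient of \<open>?v\<close> in the
    reflection is exactly 1, and \<open>u i - ?v i\<close> is \<open>w i\<close>.\<close>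
  have v: "ip n ?v ?v = 2 * ip n u ?v"
    using assms by (simp add: ip_left ip_right ip_commute[of n w u])
  show ?thesis
  proof (cases "ip n ?v ?v = 0")
    case True
    then have "?v i = 0" using assms(3) unfolding ip_self_eq_0_iff by blast
    then show ?thesis using assms(3) by (simp add: householder_def)
  next
    case False
    then show ?thesis using assms(3) v by (simp add: householder_def)
  qed
qed

lemma householder_fix: "\<lbrakk>ip n x v = 0; i < n\<rbrakk> \<Longrightarrow> householder n v x i = x i"
  by (simp add: householder_def)

text \<open>One more reflection moves the image of \<open>ws ! d\<close> to
  \<open>unit_vec d\<close>. Its normal, the difference of these two, is orthogonal to the images
  already placed, so those stay fixed.\<close>

lemma rotate_orthonormal:
  assumes "orthonormal n ws" "d \<le> length ws"
  shows "\<exists>Q. Q \<in> gauss_n n \<rightarrow>\<^sub>M gauss_n n \<and> distr (gauss_n n) (gauss_n n) Q = gauss_n n \<and>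
    (\<forall>x y. ip n (Q x) (Q y) = ip n x y) \<and> (\<forall>k<d. \<forall>i<n. Q (ws ! k) i = unit_vec k i)"
  using assms(2)
proof (induction d)
  case 0
  have "distr (gauss_n n) (gauss_n n) (\<lambda>x. x) = gauss_n n" by (rule distr_id)
  then show ?case by (intro exI[of _ "\<lambda>x. x"]) auto
next
  case (Suc d)
  then obtain Q where Q[measurable]: "Q \<in> gauss_n n \<rightarrow>\<^sub>M gauss_n n"
    and Q_distr: "distr (gauss_n n) (gauss_n n) Q = gauss_n n"
    and Q_ip: "\<And>x y. ip n (Q x) (Q y) = ip n x y"
    and Q_unit: "\<And>k i. k < d \<Longrightarrow> i < n \<Longrightarrow> Q (ws ! k) i = unit_vec k i" by auto
  have d: "d < n" using Suc.prems length_orthonormal_le[OF assms(1)] by simp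
  let ?u = "Q (ws ! d)"
  let ?v = "\<lambda>i. ?u i - unit_vec d i"
  have H[measurable]: "householder n ?v \<in> gauss_n n \<rightarrow>\<^sub>M gauss_n n"
    using householder_measurable[of n ?v] by (simp add: measurable_cong_sets[OF sets_gauss sets_gauss])
  have "ip n (Q (ws ! k)) ?v = 0" if k: "k < d" for k
  proof -
    have "ip n (Q (ws ! k)) (unit_vec d) = ip n (unit_vec k) (unit_vec d)"
      by (rule ip_cong) (use Q_unit k in auto)
    then show ?thesis
      using orthonormalD[OF assms(1), of k d] k d Suc.prems
      by (simp add: ip_right Q_ip ip_unit_vec) (simp add: unit_vec_def)
  qed
  then have "householder n ?v (Q (ws ! k)) i = unit_vec k i" if "k < d" "i < n" for k i
    using that by (simp add: householder_fix Q_unit)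
  moreover have "householder n ?v ?u i = unit_vec d i" if "i < n" for i
    using that d orthonormalD[OF assms(1), of d d] Suc.prems
    by (intro householder_swap) (simp_all add: Q_ip ip_unit_vec, simp add: unit_vec_def)
  moreover have "distr (gauss_n n) (gauss_n n) (\<lambda>x. householder n ?v (Q x)) = gauss_n n"
    using distr_distr[OF H Q] by (simp add: Q_distr distr_householder comp_def)
  ultimately show ?case
    by (intro exI[of _ "\<lambda>x. householder n ?v (Q x)"]) (auto simp: less_Suc_eq ip_householder Q_ip)
qed

text \<open>If the isometry \<open>Q\<close> maps the basis to the first standard basis vectors,
  then the inner product of \<open>g\<close> with the basis vector of index \<open>k\<close> is
  coordinate \<open>k\<close> of \<open>Q g\<close>. Thus the projection of \<open>g\<close> is
  \<open>gaussian_in\<close> at \<open>Q g\<close>, and \<open>Q g\<close> has the law of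
  \<open>g\<close>.\<close>

lemma distr_proj_eq_distr_gaussian_in:
  assumes V: "lin_subspace n V"
  shows "distr (gauss_n n) (\<Pi>\<^sub>M i\<in>{..<n}. borel) (\<lambda>g. \<lambda>i\<in>{..<n}. proj n V g i)
       = distr (gauss_n n) (\<Pi>\<^sub>M i\<in>{..<n}. borel) (\<lambda>g. \<lambda>i\<in>{..<n}. gaussian_in n V g i)"
proof -
  let ?ws = "onb n V"
  have on: "orthonormal n ?ws"
    using orthonormal_basis_onb[OF V] by (simp add: orthonormal_basis_def orthonormal_def)
  note len = length_orthonormal_le[OF on]
  obtain Q where Q: "Q \<in> gauss_n n \<rightarrow>\<^sub>M gauss_n n"
    and Q_distr: "distr (gauss_n n) (gauss_n n) Q = gauss_n n"
    and Q_ip: "\<And>x y. ip n (Q x) (Q y) = ip n x y"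
    and Q_unit: "\<And>k i. k < length ?ws \<Longrightarrow> i < n \<Longrightarrow> Q (?ws ! k) i = unit_vec k i"
    using rotate_orthonormal[OF on order_refl] by auto
  have "ip n g (?ws ! k) = Q g k" if k: "k < length ?ws" for g k
  proof -
    have "ip n g (?ws ! k) = ip n (Q g) (Q (?ws ! k))" by (simp add: Q_ip)
    also have "\<dots> = ip n (Q g) (unit_vec k)" by (rule ip_cong) (use Q_unit k in auto)
    also have "\<dots> = Q g k" using k len by (simp add: ip_unit_vec)
    finally show ?thesis .
  qed
  then have proj: "proj n V g = gaussian_in n V (Q g)" for g
    by (simp add: proj_def gaussian_in_eq)
  have [measurable]: "(\<lambda>g. \<lambda>i\<in>{..<n}. gaussian_in n V g i) \<in> gauss_n n \<rightarrow>\<^sub>M (\<Pi>\<^sub>M i\<in>{..<n}. borel)"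
    unfolding gaussian_in_eq using len
    by (intro measurable_restrict borel_measurable_sum borel_measurable_times) auto
  show ?thesis
    using distr_distr[of "\<lambda>g. \<lambda>i\<in>{..<n}. gaussian_in n V g i" "gauss_n n" _ Q "gauss_n n"] Q
    by (simp add: Q_distr comp_def proj)
qed

section \<open>Laws of walks\<close>

text \<open>The subspace as a function of a code with finitely many values, the pair of sets of
  tight indices.\<close>

definition V_of :: "ew_input \<Rightarrow> nat set \<times> nat set \<Rightarrow> (nat \<Rightarrow> real) set" where
  "V_of I = (\<lambda>(A, B). {u. (\<forall>i\<ge>dim I. u i = 0) \<and> (\<forall>i\<in>A. u i = 0) \<and> (\<forall>j\<in>B. ip (dim I) u (vec I j) = 0)})"

lemma V_space_eq_V_of: "V_space I x = V_of I (C_var I x, C_disc I x)"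
  by (simp add: V_space_def V_of_def)

lemma lin_subspace_V_of: "lin_subspace (dim I) (V_of I AB)"
  unfolding lin_subspace_def V_of_def
  by (simp add: ip_add_left ip_scale_left split: prod.split) (simp add: ip_def)

lemma C_disc_cong: "(\<And>i. i < dim I \<Longrightarrow> x i = y i) \<Longrightarrow> C_disc I x = C_disc I y"
  by (auto simp: C_disc_def ip_def)

lemma V_space_cong: "(\<And>i. i < dim I \<Longrightarrow> x i = y i) \<Longrightarrow> V_space I x = V_space I y"
  using C_disc_cong[of I x y] by (auto simp: V_space_def C_var_def)

text \<open>The subspace of a step takes only finitely many values; hence every rule that is measurable
  for each fixed subspace gives a measurable walk.\<close>

lemma measurable_C_code:
  assumes [measurable]: "\<And>i. i < dim I \<Longrightarrow> (\<lambda>z. f z i) \<in> borel_measurable M"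
  shows "(\<lambda>z. (C_var I (f z), C_disc I (f z)))
    \<in> M \<rightarrow>\<^sub>M count_space (Pow {..<dim I} \<times> Pow {..<num I})"
proof -
  have "(\<lambda>z. (C_var I (f z), C_disc I (f z))) -` {(A, B)} \<inter> space M \<in> sets M"
    if AB: "A \<subseteq> {..<dim I}" "B \<subseteq> {..<num I}" for A B
  proof -
    have "(\<lambda>z. (C_var I (f z), C_disc I (f z))) -` {(A, B)} \<inter> space M
      = {z \<in> space M. (\<forall>i\<in>{..<dim I}. (\<bar>f z i\<bar> \<ge> 1 - slack I) = (i \<in> A)) \<and>
          (\<forall>j\<in>{..<num I}. (\<bar>ip (dim I) (\<lambda>i. f z i - start I i) (vec I j)\<bar> \<ge> thr I j - slack I) = (j \<in> B))}"
      using AB by (auto simp: C_var_def C_disc_def subset_iff)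
    also have "\<dots> \<in> sets M"
    proof -
      have [measurable]: "(\<lambda>z. ip (dim I) (\<lambda>i. f z i - start I i) (vec I j)) \<in> borel_measurable M" for j
        by (rule measurable_ip) auto
      have [measurable]: "Measurable.pred M (\<lambda>z. \<forall>i\<in>{..<dim I}. (\<bar>f z i\<bar> \<ge> 1 - slack I) = (i \<in> A))"
        by (intro pred_intros_finite) auto
      show ?thesis by measurable
    qed
    finally show ?thesis .
  qed
  then show ?thesis
    by (subst measurable_count_space_eq2) (auto simp: C_var_def C_disc_def)
qed

text \<open>The rule \<open>st\<close> is \<open>gaussian_in\<close> for the walk of the definition
  and \<open>proj\<close> for that of the program, so both are covered by the same measure
  theory.\<close>

primrec gwalk :: "ew_input \<Rightarrow> ((nat \<Rightarrow> real) set \<Rightarrow> (nat \<Rightarrow> real) \<Rightarrow> nat \<Rightarrow> real) \<Rightarrow>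
    (nat \<times> nat \<Rightarrow> real) \<Rightarrow> nat \<Rightarrow> nat \<Rightarrow> real" where
  "gwalk I st g 0 = start I"
| "gwalk I st g (Suc t) =
     (\<lambda>i. gwalk I st g t i + stepsize I * st (V_space I (gwalk I st g t)) (\<lambda>k. g (t, k)) i)"

lemma walk_eq_gwalk: "walk I g t = gwalk I (gaussian_in (dim I)) g t"
  by (induction t) simp_all

text \<open>Dependence on the first \<open>n\<close> entries only allows the infinite supply of
  normals to be cut into finite blocks. Measurability is demanded for each fixed subspace; joint
  measurability with the position comes from the finite code.\<close>

definition step_rule :: "nat \<Rightarrow> ((nat \<Rightarrow> real) set \<Rightarrow> (nat \<Rightarrow> real) \<Rightarrow> nat \<Rightarrow> real) \<Rightarrow> bool" where
  "step_rule n st \<longleftrightarrow> (\<forall>V. lin_subspace n V \<longrightarrow>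
     (\<forall>h h'. (\<forall>k<n. h k = h' k) \<longrightarrow> st V h = st V h') \<and>
     (\<forall>i. (\<lambda>h. st V h i) \<in> borel_measurable (gauss_n n)))"

lemma length_onb_le: "lin_subspace n V \<Longrightarrow> length (onb n V) \<le> n"
  using orthonormal_basis_onb[of n V]
  by (intro length_orthonormal_le) (simp add: orthonormal_basis_def orthonormal_def)

lemma step_rule_gaussian_in: "step_rule n (gaussian_in n)"
  unfolding step_rule_def
proof (intro allI impI conjI)
  fix V i assume V: "lin_subspace n V"
  show "gaussian_in n V h = gaussian_in n V h'" if "\<forall>k<n. h k = h' k" for h h'
    using that length_onb_le[OF V] by (simp add: gaussian_in_eq)
  show "(\<lambda>h. gaussian_in n V h i) \<in> borel_measurable (gauss_n n)"
    unfolding gaussian_in_eq using length_onb_le[OF V]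
    by (intro borel_measurable_sum borel_measurable_times) auto
qed

lemma step_rule_proj: "step_rule n (proj n)"
  unfolding step_rule_def
proof (intro allI impI conjI)
  fix V i assume V: "lin_subspace n V"
  show "proj n V h = proj n V h'" if "\<forall>k<n. h k = h' k" for h h'
    using that by (simp add: proj_def ip_def)
  have "(\<lambda>h. ip n h w) \<in> borel_measurable (gauss_n n)" for w
    by (rule measurable_ip) auto
  then show "(\<lambda>h. proj n V h i) \<in> borel_measurable (gauss_n n)"
    unfolding proj_def gaussian_in_eq
    by (intro borel_measurable_sum borel_measurable_times) auto
qed

section \<open>Paths and their laws\<close>

definition path_index :: "ew_input \<Rightarrow> (nat \<times> nat) set" where
  "path_index I = {..iters I} \<times> {..<dim I}"

abbreviation path_space :: "ew_input \<Rightarrow> (nat \<times> nat \<Rightarrow> real) measure" where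
  "path_space I \<equiv> \<Pi>\<^sub>M p\<in>path_index I. borel"

text \<open>Freezing the path after time \<open>t\<close> puts partial paths of all lengths into one
  measurable space.\<close>

definition path_upto :: "ew_input \<Rightarrow> (nat \<Rightarrow> nat \<Rightarrow> real) \<Rightarrow> nat \<Rightarrow> nat \<times> nat \<Rightarrow> real" where
  "path_upto I X t = (\<lambda>(s, i)\<in>path_index I. X (min s t) i)"

text \<open>All entries after time \<open>t\<close> of a frozen path equal the point at time
  \<open>t\<close>; adding the step to each of them yields the path frozen one time unit
  later.\<close>

definition extend_path :: "ew_input \<Rightarrow> nat \<Rightarrow> (nat \<times> nat \<Rightarrow> real) \<Rightarrow> (nat \<Rightarrow> real) \<Rightarrow> nat \<times> nat \<Rightarrow> real" where
  "extend_path I t p u = (\<lambda>(s, i)\<in>path_index I. if s \<le> t then p (s, i) else p (s, i) + stepsize I * u i)"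

lemma path_Suc:
  assumes "t < iters I"
  shows "path_upto I (gwalk I st g) (Suc t) = extend_path I t (path_upto I (gwalk I st g) t)
    (st (V_space I (\<lambda>i. path_upto I (gwalk I st g) t (t, i))) (\<lambda>k. g (t, k)))"
proof -
  have "V_space I (\<lambda>i. path_upto I (gwalk I st g) t (t, i)) = V_space I (gwalk I st g t)"
    using assms by (intro V_space_cong) (auto simp: path_upto_def path_index_def)
  then show ?thesis
    by (auto simp: path_upto_def extend_path_def fun_eq_iff path_index_def min_def not_le le_Suc_eq
        intro: arg_cong2)
qed

lemma gwalk_cong:
  assumes st: "step_rule (dim I) st" and g: "\<And>s k. s < t \<Longrightarrow> k < dim I \<Longrightarrow> g (s, k) = g' (s, k)"
  shows "gwalk I st g t = gwalk I st g' t"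
  using g
proof (induction t)
  case (Suc t)
  then have "gwalk I st g t = gwalk I st g' t" by simp
  moreover have "st V (\<lambda>k. g (t, k)) = st V (\<lambda>k. g' (t, k))" if "lin_subspace (dim I) V" for V
    using st that Suc.prems unfolding step_rule_def by auto
  ultimately show ?case by (simp add: lin_subspace_V_space)
qed simp

lemma measurable_step:
  assumes st: "step_rule (dim I) st" and t: "t \<le> iters I"
    and p[measurable]: "p \<in> M \<rightarrow>\<^sub>M path_space I" and h[measurable]: "h \<in> M \<rightarrow>\<^sub>M gauss_n (dim I)"
  shows "(\<lambda>z. extend_path I t (p z) (st (V_space I (\<lambda>i. p z (t, i))) (h z))) \<in> M \<rightarrow>\<^sub>M path_space I"
proof -
  have comp[measurable]: "(\<lambda>z. p z q) \<in> borel_measurable M" if "q \<in> path_index I" for q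
    using measurable_compose[OF p measurable_component_singleton[OF that]] by simp
  have "(\<lambda>z. st (V_of I (C_var I (\<lambda>i. p z (t, i)), C_disc I (\<lambda>i. p z (t, i)))) (h z) i) \<in> borel_measurable M" for i
  proof (rule measurable_compose_countable'[where f = "\<lambda>AB z. st (V_of I AB) (h z) i"])
    show "(\<lambda>z. (C_var I (\<lambda>i. p z (t, i)), C_disc I (\<lambda>i. p z (t, i))))
        \<in> M \<rightarrow>\<^sub>M count_space (Pow {..<dim I} \<times> Pow {..<num I})"
      by (rule measurable_C_code) (use t in \<open>auto simp: path_index_def\<close>)
    show "(\<lambda>z. st (V_of I AB) (h z) i) \<in> borel_measurable M" for AB
      using st lin_subspace_V_of[of I AB] measurable_compose[OF h] unfolding step_rule_def by blast
    show "countable (Pow {..<dim I} \<times> Pow {..<num I})"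
      by (intro countable_finite) simp
  qed
  then have [measurable]: "(\<lambda>z. st (V_space I (\<lambda>i. p z (t, i))) (h z) i) \<in> borel_measurable M" for i
    by (simp add: V_space_eq_V_of)
  show ?thesis
    unfolding extend_path_def
    by (rule measurable_restrict) (auto split: prod.split)
qed

text \<open>The index set \<open>J\<close> may be larger than what time \<open>t\<close> requires,
  so that the induction on \<open>t\<close> can keep it fixed.\<close>

lemma measurable_path:
  assumes st: "step_rule (dim I) st"
  shows "\<lbrakk>t \<le> iters I; {..<t} \<times> {..<dim I} \<subseteq> J\<rbrakk> \<Longrightarrow>
    (\<lambda>g. path_upto I (gwalk I st g) t) \<in> (\<Pi>\<^sub>M p\<in>J. std_normal_distribution) \<rightarrow>\<^sub>M path_space I"
proof (induction t)
  case 0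
  show ?case unfolding path_upto_def by (rule measurable_restrict) (auto split: prod.split)
next
  case (Suc t)
  have [measurable]: "(\<lambda>g. path_upto I (gwalk I st g) t) \<in> (\<Pi>\<^sub>M p\<in>J. std_normal_distribution) \<rightarrow>\<^sub>M path_space I"
    using Suc.prems by (intro Suc.IH) auto
  have *: "(\<lambda>g. \<lambda>k\<in>{..<dim I}. g (t, k)) \<in> (\<Pi>\<^sub>M p\<in>J. std_normal_distribution) \<rightarrow>\<^sub>M gauss_n (dim I)"
    using Suc.prems by (intro measurable_restrict measurable_component_singleton) auto
  have "st V (\<lambda>k. g (t, k)) = st V (\<lambda>k\<in>{..<dim I}. g (t, k))" if "lin_subspace (dim I) V" for V g
    using st that unfolding step_rule_def by auto
  then have "(\<lambda>g. path_upto I (gwalk I st g) (Suc t)) = (\<lambda>g. extend_path I t (path_upto I (gwalk I st g) t)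
      (st (V_space I (\<lambda>i. path_upto I (gwalk I st g) t (t, i))) (\<lambda>k\<in>{..<dim I}. g (t, k))))"
    using Suc.prems by (simp add: path_Suc lin_subspace_V_space)
  then show ?case using measurable_step[OF st _ _ *, of t] Suc.prems by simp
qed

abbreviation gauss_upto :: "nat \<Rightarrow> nat \<Rightarrow> (nat \<times> nat \<Rightarrow> real) measure" where
  "gauss_upto n t \<equiv> \<Pi>\<^sub>M p\<in>{..<t} \<times> {..<n}. std_normal_distribution"

definition path_law :: "ew_input \<Rightarrow> ((nat \<Rightarrow> real) set \<Rightarrow> (nat \<Rightarrow> real) \<Rightarrow> nat \<Rightarrow> real) \<Rightarrow> nat \<Rightarrow>
    (nat \<times> nat \<Rightarrow> real) measure" where
  "path_law I st t = distr (gauss_upto (dim I) t) (path_space I) (\<lambda>g. path_upto I (gwalk I st g) t)"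

text \<open>The Markov property: the normals of iteration \<open>t\<close> are independent of the
  earlier ones, and the path up to \<open>t\<close> uses only the latter. Given that path, the rule
  \<open>st\<close> enters through the law of a single step.\<close>

lemma emeasure_path_law_Suc:
  assumes st: "step_rule (dim I) st" and t: "t < iters I" and A: "A \<in> sets (path_space I)"
  shows "emeasure (path_law I st (Suc t)) A = (\<integral>\<^sup>+p. \<integral>\<^sup>+h.
    indicator A (extend_path I t p (st (V_space I (\<lambda>i. p (t, i))) h)) \<partial>gauss_n (dim I) \<partial>path_law I st t)"
proof -
  let ?n = "dim I" and ?N = "\<lambda>_::nat\<times>nat. std_normal_distribution"
  let ?J = "{t} \<times> {..<?n}" and ?K = "{..<t} \<times> {..<?n}"
  let ?F = "\<lambda>p h. indicator A (extend_path I t p (st (V_space I (\<lambda>i. p (t, i))) h)) :: ennreal"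
  have un: "{..<Suc t} \<times> {..<?n} = ?K \<union> ?J" by auto
  interpret gn: prob_space "gauss_n ?n" by (intro prob_space_PiM prob_space_std_normal)
  have st_cong: "st V h = st V h'" if "lin_subspace ?n V" "\<And>k. k < ?n \<Longrightarrow> h k = h' k" for V h h'
    using st that unfolding step_rule_def by auto
  note [measurable] = A
  have P[measurable]: "(\<lambda>g. path_upto I (gwalk I st g) t) \<in> gauss_upto ?n t \<rightarrow>\<^sub>M path_space I"
    using t by (intro measurable_path[OF st]) auto
  have P'[measurable]: "(\<lambda>g. path_upto I (gwalk I st g) (Suc t)) \<in> gauss_upto ?n (Suc t) \<rightarrow>\<^sub>M path_space I"
    using t by (intro measurable_path[OF st]) auto
  have "(\<lambda>z. extend_path I t (fst z) (st (V_space I (\<lambda>i. fst z (t, i))) (snd z)))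
      \<in> path_space I \<Otimes>\<^sub>M gauss_n ?n \<rightarrow>\<^sub>M path_space I"
    using t by (intro measurable_step[OF st]) auto
  from measurable_compose[OF this borel_measurable_indicator[OF A]]
  have F: "(\<lambda>z. ?F (fst z) (snd z)) \<in> borel_measurable (path_space I \<Otimes>\<^sub>M gauss_n ?n)" .
  have F1: "?F p \<in> borel_measurable (gauss_n ?n)" if "p \<in> space (path_space I)" for p
    using measurable_compose[OF measurable_Pair1'[OF that] F] by simp
  have F2: "(\<lambda>p. \<integral>\<^sup>+h. ?F p h \<partial>gauss_n ?n) \<in> borel_measurable (path_space I)"
    using gn.borel_measurable_nn_integral[of "\<lambda>p h. ?F p h" "path_space I"] F
    by (simp add: case_prod_beta')
  \<comment> \<open>The normals of iteration \<open>t\<close>, reindexed by their second component,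
    form a standard Gaussian vector.\<close>
  have block: "distr (Pi\<^sub>M ?J ?N) (gauss_n ?n) (\<lambda>y. \<lambda>k\<in>{..<?n}. y (t, k)) = gauss_n ?n"
    by (rule distr_PiM_reindex[where f = "\<lambda>k. (t, k)"]) (auto simp: prob_space_std_normal inj_on_def)
  have block_meas: "(\<lambda>y. \<lambda>k\<in>{..<?n}. y (t, k)) \<in> Pi\<^sub>M ?J ?N \<rightarrow>\<^sub>M gauss_n ?n"
    by (intro measurable_restrict measurable_component_singleton) auto
  have "emeasure (path_law I st (Suc t)) A
      = (\<integral>\<^sup>+g. indicator A (path_upto I (gwalk I st g) (Suc t)) \<partial>gauss_upto ?n (Suc t))"
    unfolding path_law_def by (subst nn_integral_distr[symmetric, OF P']) auto
  also have "\<dots> = (\<integral>\<^sup>+x. \<integral>\<^sup>+y. indicator A (path_upto I (gwalk I st (merge ?K ?J (x, y))) (Suc t))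
      \<partial>Pi\<^sub>M ?J ?N \<partial>gauss_upto ?n t)"
    using measurable_compose[OF P' borel_measurable_indicator[OF A]] unfolding un
    by (intro gauss_prod.product_nn_integral_fold) auto
  also have "\<dots> = (\<integral>\<^sup>+x. \<integral>\<^sup>+y. ?F (path_upto I (gwalk I st x) t) (\<lambda>k\<in>{..<?n}. y (t, k)) \<partial>Pi\<^sub>M ?J ?N \<partial>gauss_upto ?n t)"
  proof (intro nn_integral_cong)
    fix x y :: "nat \<times> nat \<Rightarrow> real"
    let ?g = "merge ?K ?J (x, y)"
    have "gwalk I st ?g s = gwalk I st x s" if "s \<le> t" for s
      using that by (intro gwalk_cong[OF st]) (auto simp: merge_def)
    then have "path_upto I (gwalk I st ?g) t = path_upto I (gwalk I st x) t"
      by (simp add: path_upto_def)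
    moreover have "st V (\<lambda>k. ?g (t, k)) = st V (\<lambda>k\<in>{..<?n}. y (t, k))" if "lin_subspace ?n V" for V
      using that by (rule st_cong) (simp add: merge_def)
    ultimately show "indicator A (path_upto I (gwalk I st ?g) (Suc t))
        = ?F (path_upto I (gwalk I st x) t) (\<lambda>k\<in>{..<?n}. y (t, k))"
      using t by (simp add: path_Suc lin_subspace_V_space)
  qed
  also have "\<dots> = (\<integral>\<^sup>+x. \<integral>\<^sup>+h. ?F (path_upto I (gwalk I st x) t) h \<partial>gauss_n ?n \<partial>gauss_upto ?n t)"
  proof (rule nn_integral_cong)
    fix x assume "x \<in> space (gauss_upto ?n t)"
    then have p: "path_upto I (gwalk I st x) t \<in> space (path_space I)" using P by (rule measurable_space[rotated])
    show "(\<integral>\<^sup>+y. ?F (path_upto I (gwalk I st x) t) (\<lambda>k\<in>{..<?n}. y (t, k)) \<partial>Pi\<^sub>M ?J ?N)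
        = (\<integral>\<^sup>+h. ?F (path_upto I (gwalk I st x) t) h \<partial>gauss_n ?n)"
      using nn_integral_distr[OF block_meas, of "?F (path_upto I (gwalk I st x) t)"] F1[OF p]
      by (simp only: block)
  qed
  also have "\<dots> = (\<integral>\<^sup>+p. \<integral>\<^sup>+h. ?F p h \<partial>gauss_n ?n \<partial>path_law I st t)"
    unfolding path_law_def by (rule nn_integral_distr[symmetric, OF P]) (use F2 in simp)
  finally show ?thesis .
qed

text \<open>In the Markov formula the inner integral depends only on the law of the step for one
  fixed subspace, where the two rules agree; the outer measures agree by induction.\<close>

lemma path_law_cong:
  assumes st: "step_rule (dim I) st" "step_rule (dim I) st'"
    and law: "\<And>V. lin_subspace (dim I) V \<Longrightarrow>
      distr (gauss_n (dim I)) (\<Pi>\<^sub>M i\<in>{..<dim I}. borel) (\<lambda>g. \<lambda>i\<in>{..<dim I}. st V g i) =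
      distr (gauss_n (dim I)) (\<Pi>\<^sub>M i\<in>{..<dim I}. borel) (\<lambda>g. \<lambda>i\<in>{..<dim I}. st' V g i)"
  shows "t \<le> iters I \<Longrightarrow> path_law I st t = path_law I st' t"
proof (induction t)
  case 0
  then show ?case by (simp add: path_law_def path_upto_def)
next
  case (Suc t)
  let ?n = "dim I"
  show ?case
  proof (rule measure_eqI)
    show "sets (path_law I st (Suc t)) = sets (path_law I st' (Suc t))" by (simp add: path_law_def)
    fix A assume "A \<in> sets (path_law I st (Suc t))"
    then have A: "A \<in> sets (path_space I)" by (simp add: path_law_def)
    \<comment> \<open>The inner integral becomes an integral over the law of the step, to which the
      hypothesis \<open>law\<close> applies. Restricting the step is harmless because a path stores
      only coordinates below the dimension.\<close>
    have inner: "(\<integral>\<^sup>+h. indicator A (extend_path I t p (st (V_space I (\<lambda>i. p (t, i))) h)) \<partial>gauss_n ?n)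
        = (\<integral>\<^sup>+u. indicator A (extend_path I t p u) \<partial>
            distr (gauss_n ?n) (\<Pi>\<^sub>M i\<in>{..<?n}. borel) (\<lambda>g. \<lambda>i\<in>{..<?n}. st (V_space I (\<lambda>i. p (t, i))) g i))"
      if st: "step_rule ?n st" and p: "p \<in> space (path_space I)" for p st
    proof -
      let ?V = "V_space I (\<lambda>i. p (t, i))"
      have u: "(\<lambda>g. \<lambda>i\<in>{..<?n}. st ?V g i) \<in> gauss_n ?n \<rightarrow>\<^sub>M (\<Pi>\<^sub>M i\<in>{..<?n}. borel)"
        using st lin_subspace_V_space[of I "\<lambda>i. p (t, i)"] unfolding step_rule_def
        by (intro measurable_restrict) auto
      have E: "extend_path I t p \<in> (\<Pi>\<^sub>M i\<in>{..<?n}. borel) \<rightarrow>\<^sub>M path_space I"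
        unfolding extend_path_def
        by (rule measurable_restrict) (auto simp: path_index_def split: prod.split)
      have "extend_path I t p (st ?V h) = extend_path I t p (\<lambda>i\<in>{..<?n}. st ?V h i)" for h
        by (auto simp: extend_path_def path_index_def fun_eq_iff)
      then show ?thesis
        using measurable_compose[OF E borel_measurable_indicator[OF A]]
        by (subst nn_integral_distr[OF u]) simp_all
    qed
    have space: "space (path_law I st' t) = space (path_space I)" by (simp add: path_law_def)
    have "(\<integral>\<^sup>+p. \<integral>\<^sup>+h. indicator A (extend_path I t p (st (V_space I (\<lambda>i. p (t, i))) h)) \<partial>gauss_n ?n \<partial>path_law I st' t)
      = (\<integral>\<^sup>+p. \<integral>\<^sup>+h. indicator A (extend_path I t p (st' (V_space I (\<lambda>i. p (t, i))) h)) \<partial>gauss_n ?n \<partial>path_law I st' t)"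
      by (rule nn_integral_cong) (simp add: inner[OF st(1)] inner[OF st(2)] space law lin_subspace_V_space)
    then show "emeasure (path_law I st (Suc t)) A = emeasure (path_law I st' (Suc t)) A"
      using Suc A st by (simp add: emeasure_path_law_Suc)
  qed
qed

lemma path_law_proj: "t \<le> iters I \<Longrightarrow> path_law I (proj (dim I)) t = path_law I (gaussian_in (dim I)) t"
  by (intro path_law_cong step_rule_proj step_rule_gaussian_in distr_proj_eq_distr_gaussian_in)

text \<open>Distinct members of an independent identically distributed family may be assigned to the
  pairs in any way. The identity serves the definition, whose normals are indexed by pairs; the
  program needs the position of a pair in its sample sequence.\<close>

lemma distr_path_reindex:
  assumes st: "step_rule (dim I) st" and f: "inj_on f ({..<iters I} \<times> {..<dim I})"
  shows "(\<lambda>\<omega>. path_upto I (gwalk I st (\<lambda>p. \<omega> (f p))) (iters I)) \<in> (\<Pi>\<^sub>M k\<in>UNIV. std_normal_distribution) \<rightarrow>\<^sub>M path_space I"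
    and "distr (\<Pi>\<^sub>M k\<in>UNIV. std_normal_distribution) (path_space I)
      (\<lambda>\<omega>. path_upto I (gwalk I st (\<lambda>p. \<omega> (f p))) (iters I)) = path_law I st (iters I)"
proof -
  let ?U = "\<Pi>\<^sub>M k\<in>UNIV. std_normal_distribution" and ?G = "gauss_upto (dim I) (iters I)"
  let ?r = "\<lambda>\<omega>. \<lambda>p\<in>{..<iters I} \<times> {..<dim I}. \<omega> (f p)"
  have r: "?r \<in> ?U \<rightarrow>\<^sub>M ?G"
    by (intro measurable_restrict measurable_component_singleton) auto
  have P: "(\<lambda>g. path_upto I (gwalk I st g) (iters I)) \<in> ?G \<rightarrow>\<^sub>M path_space I"
    by (rule measurable_path[OF st]) auto
  have "gwalk I st (\<lambda>p. \<omega> (f p)) s = gwalk I st (?r \<omega>) s" if "s \<le> iters I" for \<omega> s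
    using that by (intro gwalk_cong[OF st]) auto
  then have eq: "(\<lambda>\<omega>. path_upto I (gwalk I st (\<lambda>p. \<omega> (f p))) (iters I))
      = (\<lambda>g. path_upto I (gwalk I st g) (iters I)) \<circ> ?r"
    by (auto simp: path_upto_def path_index_def fun_eq_iff)
  show "(\<lambda>\<omega>. path_upto I (gwalk I st (\<lambda>p. \<omega> (f p))) (iters I)) \<in> ?U \<rightarrow>\<^sub>M path_space I"
    unfolding eq by (rule measurable_comp[OF r P])
  have "distr ?U ?G ?r = ?G"
    using f by (intro distr_PiM_reindex) (auto simp: prob_space_std_normal)
  then show "distr ?U (path_space I) (\<lambda>\<omega>. path_upto I (gwalk I st (\<lambda>p. \<omega> (f p))) (iters I)) = path_law I st (iters I)"
    unfolding eq path_law_def by (subst distr_distr[OF P r, symmetric]) simp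
qed

definition full_set :: "ew_input \<Rightarrow> (nat \<Rightarrow> real) set" where
  "full_set I = {x. card (C_disc I x) \<ge> dim I}"

text \<open>A least element instead of the minimum of a set, because this form suits both the
  measurability proof and the verification of the program.\<close>

definition stop_time :: "ew_input \<Rightarrow> (nat \<Rightarrow> nat \<Rightarrow> real) \<Rightarrow> nat" where
  "stop_time I X = (LEAST t. t = iters I \<or> t < iters I \<and> X t \<in> full_set I)"

lemma completed_eq_stop_time: "completed I (full_set I) g = stop_time I (walk I g)"
proof -
  have "insert (iters I) {t. t < iters I \<and> walk I g t \<in> full_set I}
      = {t. t = iters I \<or> t < iters I \<and> walk I g t \<in> full_set I}" by auto
  then show ?thesis
    unfolding completed_def stop_time_def by (subst Least_Min) (auto simp: Collect_disj_eq)
qed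

text \<open>A run is a fixed measurable function of the walk continued to time \<open>T\<close>,
  whether it has failed or not; hence equal path laws give equal run laws.\<close>

definition run_of_path :: "ew_input \<Rightarrow> (nat \<times> nat \<Rightarrow> real) \<Rightarrow> nat \<times> (nat \<times> nat \<Rightarrow> real)" where
  "run_of_path I p = run_of I (stop_time I (\<lambda>t i. p (t, i))) (\<lambda>t i. p (t, i))"

lemma stop_time_le: "stop_time I X \<le> iters I"
  unfolding stop_time_def by (rule Least_le) simp

lemma run_of_path_path: "run_of_path I (path_upto I X (iters I)) = run_of I (stop_time I X) X"
proof -
  have "(\<lambda>i. path_upto I X (iters I) (t, i)) \<in> full_set I \<longleftrightarrow> X t \<in> full_set I" if "t < iters I" for t
    using that C_disc_cong[of I "\<lambda>i. path_upto I X (iters I) (t, i)" "X t"]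
    by (simp add: full_set_def path_upto_def path_index_def)
  then have "stop_time I (\<lambda>t i. path_upto I X (iters I) (t, i)) = stop_time I X"
    unfolding stop_time_def by (intro arg_cong[where f = Least] ext) auto
  moreover have "run_of I \<tau> (\<lambda>t i. path_upto I X (iters I) (t, i)) = run_of I \<tau> X" if "\<tau> \<le> iters I" for \<tau>
    using that by (auto simp: run_of_def path_upto_def path_index_def fun_eq_iff)
  ultimately show ?thesis using stop_time_le[of I X] by (simp add: run_of_path_def)
qed

text \<open>Failure at a given time is decided by the finite code of tight sets. The stopping time
  has countably many values, and for each fixed value the truncated path is measurable.\<close>

lemma measurable_run_of_path: "run_of_path I \<in> path_space I \<rightarrow>\<^sub>M run_space I"
proof -
  have comp[measurable]: "(\<lambda>p. p (t, i)) \<in> borel_measurable (path_space I)" if "t \<le> iters I" "i < dim I" for t i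
    using that by (auto simp: path_index_def)
  have full: "Measurable.pred (path_space I) (\<lambda>p. (\<lambda>i. p (t, i)) \<in> full_set I)" if "t < iters I" for t
  proof -
    have "(\<lambda>p. (C_var I (\<lambda>i. p (t, i)), C_disc I (\<lambda>i. p (t, i))))
        \<in> path_space I \<rightarrow>\<^sub>M count_space (Pow {..<dim I} \<times> Pow {..<num I})"
      using that by (intro measurable_C_code) auto
    then have "(\<lambda>p. dim I \<le> card (snd (C_var I (\<lambda>i. p (t, i)), C_disc I (\<lambda>i. p (t, i)))))
        \<in> path_space I \<rightarrow>\<^sub>M count_space UNIV"
      by (rule measurable_compose) auto
    then show ?thesis by (simp add: full_set_def)
  qed
  have "(\<lambda>p. t = iters I \<or> t < iters I \<and> (\<lambda>i. p (t, i)) \<in> full_set I)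
      \<in> path_space I \<rightarrow>\<^sub>M count_space UNIV" for t
    using full[of t] by (cases "t < iters I") auto
  then have \<tau>: "(\<lambda>p. stop_time I (\<lambda>t i. p (t, i))) \<in> path_space I \<rightarrow>\<^sub>M count_space UNIV"
    unfolding stop_time_def by (rule measurable_Least)
  have "(\<lambda>p. \<lambda>(t, i)\<in>{..iters I} \<times> {..<dim I}. p (min t \<tau>, i)) \<in> path_space I \<rightarrow>\<^sub>M
      (\<Pi>\<^sub>M p\<in>{..iters I} \<times> {..<dim I}. borel)" for \<tau>
    by (rule measurable_restrict) (auto split: prod.split simp: min_def)
  from measurable_compose_countable[OF this \<tau>]
  show ?thesis
    unfolding run_of_path_def run_of_def run_space_def using \<tau> by (intro measurable_Pair)
qed

lemma edge_walk_law_eq: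
  "edge_walk_law I (full_set I) = distr (path_law I (gaussian_in (dim I)) (iters I)) (run_space I) (run_of_path I)"
proof -
  note P = distr_path_reindex[OF step_rule_gaussian_in[of "dim I"], of "\<lambda>p. p", simplified]
  have "(\<lambda>g. run_of I (completed I (full_set I) g) (walk I g))
      = run_of_path I \<circ> (\<lambda>g. path_upto I (gwalk I (gaussian_in (dim I)) g) (iters I))"
    by (auto simp: run_of_path_path completed_eq_stop_time walk_eq_gwalk[abs_def] comp_def)
  then show ?thesis
    unfolding edge_walk_law_def by (simp add: distr_distr[OF measurable_run_of_path P(1), symmetric] P(2))
qed

text \<open>The interface between probability and program: it remains to show that the program
  outputs this run for every sample sequence.\<close>

lemma sample_law_eq:
  fixes I defines "X \<equiv> \<lambda>\<omega>. gwalk I (proj (dim I)) (\<lambda>(t, k). \<omega> (t * dim I + k))"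
  shows "(\<lambda>\<omega>. run_of I (stop_time I (X \<omega>)) (X \<omega>)) \<in> sample_space \<rightarrow>\<^sub>M run_space I"
    and "distr sample_space (run_space I) (\<lambda>\<omega>. run_of I (stop_time I (X \<omega>)) (X \<omega>)) = edge_walk_law I (full_set I)"
proof -
  let ?f = "\<lambda>(t, k). t * dim I + k"
  \<comment> \<open>Division by the dimension recovers \<open>t\<close>, since \<open>k\<close> is
    smaller than the dimension.\<close>
  have "inj_on ?f ({..<iters I} \<times> {..<dim I})"
  proof (rule inj_onI, clarify)
    fix t k t' k' assume k: "k < dim I" "k' < dim I" and eq: "t * dim I + k = t' * dim I + k'"
    have "t = (t * dim I + k) div dim I" "t' = (t' * dim I + k') div dim I" using k by simp_all
    with eq show "t = t' \<and> k = k'" by simp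
  qed
  note P = distr_path_reindex[OF step_rule_proj this]
  have X: "X \<omega> = gwalk I (proj (dim I)) (\<lambda>p. \<omega> (?f p))" for \<omega>
    by (simp add: X_def case_prod_unfold)
  have eq: "(\<lambda>\<omega>. run_of I (stop_time I (X \<omega>)) (X \<omega>))
      = run_of_path I \<circ> (\<lambda>\<omega>. path_upto I (gwalk I (proj (dim I)) (\<lambda>p. \<omega> (?f p))) (iters I))"
    by (simp add: run_of_path_path X comp_def)
  show "(\<lambda>\<omega>. run_of I (stop_time I (X \<omega>)) (X \<omega>)) \<in> sample_space \<rightarrow>\<^sub>M run_space I"
    unfolding eq sample_space_def by (rule measurable_comp[OF P(1) measurable_run_of_path])
  show "distr sample_space (run_space I) (\<lambda>\<omega>. run_of I (stop_time I (X \<omega>)) (X \<omega>)) = edge_walk_law I (full_set I)"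
    unfolding eq sample_space_def edge_walk_law_eq
    by (simp add: distr_distr[OF measurable_run_of_path P(1), symmetric] P(2) path_law_proj)
qed

section \<open>Running time and correctness of programs\<close>

text \<open>Total correctness with a postcondition on running time and final store; an existential
  suffices because execution is deterministic.\<close>

definition wp :: "(nat \<Rightarrow> real) \<Rightarrow> com \<Rightarrow> store \<Rightarrow> (nat \<Rightarrow> store \<Rightarrow> bool) \<Rightarrow> bool" where
  "wp \<omega> c s Q \<longleftrightarrow> (\<exists>k s'. exec \<omega> c s k s' \<and> Q k s')"

lemma wpE: "wp \<omega> c s Q \<Longrightarrow> (\<And>k s'. exec \<omega> c s k s' \<Longrightarrow> Q k s' \<Longrightarrow> thesis) \<Longrightarrow> thesis"
  by (auto simp: wp_def)

lemma wp_mono: "wp \<omega> c s Q \<Longrightarrow> (\<And>k s'. Q k s' \<Longrightarrow> R k s') \<Longrightarrow> wp \<omega> c s R"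
  by (auto simp: wp_def)

lemma wp_Skip: "Q 1 s \<Longrightarrow> wp \<omega> Skip s Q"
  unfolding wp_def using exec.Skip by blast

lemma wp_NAssign: "Q (1 + ncost a) (set_nvar x (nval a s) s) \<Longrightarrow> wp \<omega> (NAssign x a) s Q"
  unfolding wp_def using exec.NAssign by blast

lemma wp_RAssign:
  "Q (1 + ncost a + ncost b + rcost e) (set_arr x (nval a s) (nval b s) (rval e s) s)
   \<Longrightarrow> wp \<omega> (RAssign x a b e) s Q"
  unfolding wp_def using exec.RAssign by blast

lemma wp_Sample:
  "Q (1 + ncost a + ncost b) ((set_arr x (nval a s) (nval b s) (\<omega> (drawn s)) s)\<lparr>drawn := Suc (drawn s)\<rparr>)
   \<Longrightarrow> wp \<omega> (Sample x a b) s Q"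
  unfolding wp_def using exec.Sample by blast

lemma wp_Seq: "wp \<omega> c s (\<lambda>k s'. wp \<omega> d s' (\<lambda>l. Q (k + l))) \<Longrightarrow> wp \<omega> (Seq c d) s Q"
  unfolding wp_def using exec.Seq by blast

lemma wp_Cond:
  "\<lbrakk>bval b s \<Longrightarrow> wp \<omega> c s (\<lambda>k. Q (1 + bcost b + k)); \<not> bval b s \<Longrightarrow> wp \<omega> d s (\<lambda>k. Q (1 + bcost b + k))\<rbrakk>
   \<Longrightarrow> wp \<omega> (Cond b c d) s Q"
  unfolding wp_def using exec.CondTrue exec.CondFalse by blast

section \<open>Frame conditions\<close>

primrec nmods :: "com \<Rightarrow> name set" where
  "nmods Skip = {}"
| "nmods (NAssign x a) = {x}"
| "nmods (RAssign x a b e) = {}"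
| "nmods (Sample x a b) = {}"
| "nmods (Seq c d) = nmods c \<union> nmods d"
| "nmods (Cond b c d) = nmods c \<union> nmods d"
| "nmods (While b c) = nmods c"

primrec amods :: "com \<Rightarrow> name set" where
  "amods Skip = {}"
| "amods (NAssign x a) = {}"
| "amods (RAssign x a b e) = {x}"
| "amods (Sample x a b) = {x}"
| "amods (Seq c d) = amods c \<union> amods d"
| "amods (Cond b c d) = amods c \<union> amods d"
| "amods (While b c) = amods c"

primrec sampling :: "com \<Rightarrow> bool" where
  "sampling Skip = False"
| "sampling (NAssign x a) = False"
| "sampling (RAssign x a b e) = False"
| "sampling (Sample x a b) = True"
| "sampling (Seq c d) = (sampling c \<or> sampling d)"
| "sampling (Cond b c d) = (sampling c \<or> sampling d)"
| "sampling (While b c) = sampling c"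

definition frame :: "name set \<Rightarrow> name set \<Rightarrow> store \<Rightarrow> store \<Rightarrow> bool" where
  "frame N A s s' \<longleftrightarrow> (\<forall>y. y \<notin> N \<longrightarrow> nvar s' y = nvar s y) \<and> (\<forall>y. y \<notin> A \<longrightarrow> arr s' y = arr s y)"

lemma frameD: "frame N A s s' \<Longrightarrow> y \<notin> N \<Longrightarrow> nvar s' y = nvar s y"
  "frame N A s s' \<Longrightarrow> y \<notin> A \<Longrightarrow> arr s' y = arr s y"
  by (auto simp: frame_def)

lemma frame_refl: "frame N A s s"
  by (simp add: frame_def)

lemma frame_trans:
  "\<lbrakk>frame N A s s'; frame N' A' s' s''; N \<union> N' \<subseteq> N''; A \<union> A' \<subseteq> A''\<rbrakk> \<Longrightarrow> frame N'' A'' s s''"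
  unfolding frame_def by (metis UnCI subsetD)

lemma frame_mono: "frame N A s s' \<Longrightarrow> N \<subseteq> N' \<Longrightarrow> A \<subseteq> A' \<Longrightarrow> frame N' A' s s'"
  by (auto simp: frame_def)

lemma store_simps [simp]:
  "nvar (set_nvar x k s) = (nvar s)(x := k)"
  "arr (set_nvar x k s) = arr s"
  "drawn (set_nvar x k s) = drawn s"
  "nvar (set_arr x i j r s) = nvar s"
  "arr (set_arr x i j r s) = (arr s)(x := (arr s x)(i := (arr s x i)(j := r)))"
  "drawn (set_arr x i j r s) = drawn s"
  by (simp_all add: set_nvar_def set_arr_def)

lemma exec_frame: "exec \<omega> c s k s' \<Longrightarrow> frame (nmods c) (amods c) s s'"
proof (induction rule: exec.induct)
  case (Seq c s k s' d l s'')
  then show ?case by (intro frame_trans[OF Seq.IH]) auto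
next
  case (WhileTrue b s c k s' l s'')
  then show ?case by (intro frame_trans[OF WhileTrue.IH]) auto
qed (auto simp: frame_def)

lemma exec_drawn: "exec \<omega> c s k s' \<Longrightarrow> \<not> sampling c \<Longrightarrow> drawn s' = drawn s"
  by (induction rule: exec.induct) auto

text \<open>What is nowhere an assignment target keeps its value, and a program without
  \<open>Sample\<close> leaves the sample counter alone; specifications therefore need not mention
  either.\<close>

lemma wp_frame:
  "wp \<omega> c s (\<lambda>k s'. frame (nmods c) (amods c) s s' \<longrightarrow> (\<not> sampling c \<longrightarrow> drawn s' = drawn s) \<longrightarrow> Q k s') \<Longrightarrow> wp \<omega> c s Q"
  unfolding wp_def using exec_frame exec_drawn by blast

section \<open>Counting loops and their running time\<close>

definition For :: "name \<Rightarrow> nexp \<Rightarrow> com \<Rightarrow> com" where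
  "For i e c = Seq (NAssign i (NConst 0))
     (While (NLess (NVar i) e) (Seq c (NAssign i (NAdd (NVar i) (NConst 1)))))"

lemma For_mods [simp]:
  "nmods (For i e c) = insert i (nmods c)" "amods (For i e c) = amods c" "sampling (For i e c) = sampling c"
  by (auto simp: For_def)

text \<open>The parameter \<open>a\<close> of \<open>J\<close> accumulates the time spent in the
  body. The overhead per round is 1 for the loop, \<open>2 + ncost e\<close> for the test and 4 for
  the increment; the last, failing test costs \<open>3 + ncost e\<close>.\<close>

lemma wp_While_upto:
  assumes step: "\<And>k a s. \<lbrakk>k < N; J k a s; nvar s i = k\<rbrakk> \<Longrightarrow>
      wp \<omega> c s (\<lambda>k' s'. nvar s' i = k \<and> J (Suc k) (a + k') (set_nvar i (Suc k) s'))"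
    and bound: "\<And>k a s. J k a s \<Longrightarrow> nval e s = N"
  shows "\<lbrakk>k \<le> N; J k a s; nvar s i = k\<rbrakk> \<Longrightarrow>
    wp \<omega> (While (NLess (NVar i) e) (Seq c (NAssign i (NAdd (NVar i) (NConst 1))))) s
      (\<lambda>l s'. \<exists>a'. J N a' s' \<and> nvar s' i = N \<and> l + a = a' + (N - k) * (7 + ncost e) + (3 + ncost e))"
proof (induction "N - k" arbitrary: k a s)
  case 0
  then have "k = N" by simp
  then show ?case
    using 0 bound[of k a s] exec.WhileFalse[of "NLess (NVar i) e" s \<omega>] unfolding wp_def by fastforce
next
  case (Suc d)
  then have k: "k < N" by simp
  let ?b = "NLess (NVar i) e" and ?c = "Seq c (NAssign i (NAdd (NVar i) (NConst 1)))"
  obtain k' s' where e1: "exec \<omega> c s k' s'" and s': "nvar s' i = k" "J (Suc k) (a + k') (set_nvar i (Suc k) s')"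
    using step[OF k Suc.prems(2,3)] by (rule wpE) auto
  have e2: "exec \<omega> ?c s (k' + 4) (set_nvar i (Suc k) s')"
    using exec.Seq[OF e1 exec.NAssign[of \<omega> i "NAdd (NVar i) (NConst 1)" s']] s'(1) by (simp add: eval_nat_numeral)
  have "d = N - Suc k" "Suc k \<le> N" using Suc.hyps(2) k by auto
  from Suc.hyps(1)[OF this s'(2)] obtain l s'' a' where
    e3: "exec \<omega> (While ?b ?c) (set_nvar i (Suc k) s') l s''" and
    fin: "J N a' s''" "nvar s'' i = N" "l + (a + k') = a' + (N - Suc k) * (7 + ncost e) + (3 + ncost e)"
    by (auto simp: wp_def)
  have "bval ?b s" using bound[OF Suc.prems(2)] Suc.prems k by simp
  from exec.WhileTrue[OF this e2 e3]
  have e: "exec \<omega> (While ?b ?c) s (1 + bcost ?b + (k' + 4) + l) s''" .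
  have "N - k = Suc (N - Suc k)" using k by simp
  then have "1 + bcost ?b + (k' + 4) + l + a = a' + (N - k) * (7 + ncost e) + (3 + ncost e)"
    using fin(3) by simp
  with e fin(1,2) show ?case unfolding wp_def by blast
qed

lemma wp_For:
  assumes init: "J 0 0 (set_nvar i 0 s)"
    and step: "\<And>k a s'. \<lbrakk>k < N; J k a s'; nvar s' i = k; frame (insert i (nmods c)) (amods c) s s'\<rbrakk> \<Longrightarrow>
      wp \<omega> c s' (\<lambda>k' s''. J (Suc k) (a + k') (set_nvar i (Suc k) s''))"
    and i: "i \<notin> nmods c"
    and bound: "\<And>s'. frame (insert i (nmods c)) (amods c) s s' \<Longrightarrow> nval e s' = N"
    and post: "\<And>a s'. \<lbrakk>J N a s'; frame (insert i (nmods c)) (amods c) s s'\<rbrakk> \<Longrightarrow>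
      Q (a + N * (7 + ncost e) + (5 + ncost e)) s'"
  shows "wp \<omega> (For i e c) s Q"
proof -
  let ?fr = "frame (insert i (nmods c)) (amods c)"
  let ?J = "\<lambda>k a s'. J k a s' \<and> ?fr s s'"
  have "wp \<omega> (While (NLess (NVar i) e) (Seq c (NAssign i (NAdd (NVar i) (NConst 1))))) (set_nvar i 0 s)
      (\<lambda>l s'. \<exists>a'. ?J N a' s' \<and> nvar s' i = N \<and> l + 0 = a' + (N - 0) * (7 + ncost e) + (3 + ncost e))"
  proof (rule wp_While_upto)
    fix k a s' assume k: "k < N" "?J k a s'" "nvar s' i = k"
    obtain k' s'' where e: "exec \<omega> c s' k' s''" and J: "J (Suc k) (a + k') (set_nvar i (Suc k) s'')"
      using step[OF k(1) conjunct1[OF k(2)] k(3) conjunct2[OF k(2)]] by (rule wpE)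
    have fr: "frame (nmods c) (amods c) s' s''" by (rule exec_frame[OF e])
    then have "nvar s'' i = k" using i k(3) by (simp add: frameD)
    moreover have "?fr s (set_nvar i (Suc k) s'')"
      using k(2) fr by (auto simp: frame_def)
    ultimately show "wp \<omega> c s' (\<lambda>k' s''. nvar s'' i = k \<and> ?J (Suc k) (a + k') (set_nvar i (Suc k) s''))"
      using e J unfolding wp_def by blast
  qed (use init bound in \<open>auto simp: frame_def\<close>)
  note loop = this
  show ?thesis
    unfolding For_def
  proof (rule wp_Seq, rule wp_NAssign, simp only: nval.simps, rule wp_mono[OF loop], elim exE conjE)
    fix l s' a' assume "J N a' s'" "?fr s s'" "l + 0 = a' + (N - 0) * (7 + ncost e) + (3 + ncost e)"
    moreover from this(3) have "1 + ncost (NConst 0) + l = a' + N * (7 + ncost e) + (5 + ncost e)" by simp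
    ultimately show "Q (1 + ncost (NConst 0) + l) s'" using post by (simp only:)
  qed
qed

section \<open>Sums, row updates and orthogonalisation\<close>

abbreviation nI where "nI \<equiv> NVar ''i''"
abbreviation nN where "nN \<equiv> NVar ''n''"
abbreviation n0 where "n0 \<equiv> NConst 0"

definition dot :: "rexp \<Rightarrow> name \<Rightarrow> com" where
  "dot e x = Seq (RAssign x n0 n0 (RConst 0))
     (For ''i'' nN (RAssign x n0 n0 (RAdd (RGet x n0 n0) e)))"

lemma dot_mods [simp]: "nmods (dot e x) = {''i''}" "amods (dot e x) = {x}" "\<not> sampling (dot e x)"
  by (auto simp: dot_def)

lemma wp_dot:
  assumes e: "\<And>s'. frame {''i''} {x} s s' \<Longrightarrow> nvar s' ''i'' < nvar s ''n'' \<Longrightarrow> rval e s' = E (nvar s' ''i'')"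
    and post: "\<And>s'. \<lbrakk>frame {''i''} {x} s s'; arr s' x 0 0 = (\<Sum>i<nvar s ''n''. E i)\<rbrakk> \<Longrightarrow>
      Q (nvar s ''n'' * (15 + rcost e) + 10) s'"
  shows "wp \<omega> (dot e x) s Q"
  unfolding dot_def
proof (intro wp_Seq wp_RAssign)
  let ?s = "set_arr x (nval n0 s) (nval n0 s) (rval (RConst 0) s) s"
  have fr: "frame {} {x} s ?s" by (simp add: frame_def)
  show "wp \<omega> (For ''i'' nN (RAssign x n0 n0 (RAdd (RGet x n0 n0) e))) ?s
     (\<lambda>l. Q (1 + ncost n0 + ncost n0 + rcost (RConst 0) + l))"
  proof (rule wp_For[where N = "nvar s ''n''"
        and J = "\<lambda>k a s'. a = k * (7 + rcost e) \<and> arr s' x 0 0 = (\<Sum>i<k. E i)"])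
    fix k a s'
    assume J: "a = k * (7 + rcost e) \<and> arr s' x 0 0 = (\<Sum>i<k. E i)" and k: "nvar s' ''i'' = k" "k < nvar s ''n''"
      and "frame (insert ''i'' (nmods (RAssign x n0 n0 (RAdd (RGet x n0 n0) e))))
        (amods (RAssign x n0 n0 (RAdd (RGet x n0 n0) e))) ?s s'"
    then have "frame {''i''} {x} s s'" by (intro frame_trans[OF fr]) auto
    from e[OF this] k J
    show "wp \<omega> (RAssign x n0 n0 (RAdd (RGet x n0 n0) e)) s'
        (\<lambda>k' s''. a + k' = Suc k * (7 + rcost e) \<and> arr (set_nvar ''i'' (Suc k) s'') x 0 0 = (\<Sum>i<Suc k. E i))"
      by (intro wp_RAssign) simp
  next
    fix a s'
    assume J: "a = nvar s ''n'' * (7 + rcost e) \<and> arr s' x 0 0 = (\<Sum>i<nvar s ''n''. E i)"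
      and "frame (insert ''i'' (nmods (RAssign x n0 n0 (RAdd (RGet x n0 n0) e))))
        (amods (RAssign x n0 n0 (RAdd (RGet x n0 n0) e))) ?s s'"
    then have "frame {''i''} {x} s s'" by (intro frame_trans[OF fr]) auto
    from post[OF this] J
    show "Q (1 + ncost n0 + ncost n0 + rcost (RConst 0) + (a + nvar s ''n'' * (7 + ncost nN) + (5 + ncost nN))) s'"
      by (simp add: algebra_simps)
  qed (auto simp: frameD)
qed

definition vecset :: "name \<Rightarrow> nexp \<Rightarrow> rexp \<Rightarrow> com" where
  "vecset x \<beta> e = For ''i'' nN (RAssign x \<beta> nI e)"

lemma vecset_mods [simp]:
  "nmods (vecset x \<beta> e) = {''i''}" "amods (vecset x \<beta> e) = {x}" "\<not> sampling (vecset x \<beta> e)"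
  by (auto simp: vecset_def)

text \<open>The expression is evaluated in a partly overwritten row. Its hypothesis records that the
  entries from the current one on are still the old ones, which permits in-place updates.\<close>

lemma wp_vecset:
  assumes row: "\<And>s'. frame {''i''} {x} s s' \<Longrightarrow> nval \<beta> s' = \<rho>"
    and e: "\<And>s'. \<lbrakk>frame {''i''} {x} s s'; nvar s' ''i'' < nvar s ''n'';
        \<And>r c. arr s' x r c = (if r = \<rho> \<and> c < nvar s' ''i'' then E c else arr s x r c)\<rbrakk> \<Longrightarrow>
      rval e s' = E (nvar s' ''i'')"
    and post: "\<And>s'. \<lbrakk>frame {''i''} {x} s s';
        \<And>r c. arr s' x r c = (if r = \<rho> \<and> c < nvar s ''n'' then E c else arr s x r c)\<rbrakk> \<Longrightarrow>
      Q (nvar s ''n'' * (10 + ncost \<beta> + rcost e) + 6) s'"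
  shows "wp \<omega> (vecset x \<beta> e) s Q"
  unfolding vecset_def
proof (rule wp_For[where N = "nvar s ''n''"
      and J = "\<lambda>k a s'. a = k * (2 + ncost \<beta> + rcost e) \<and>
        (\<forall>r c. arr s' x r c = (if r = \<rho> \<and> c < k then E c else arr s x r c))"])
  fix k a s'
  assume k: "k < nvar s ''n''" "nvar s' ''i'' = k"
    and J: "a = k * (2 + ncost \<beta> + rcost e) \<and>
        (\<forall>r c. arr s' x r c = (if r = \<rho> \<and> c < k then E c else arr s x r c))"
    and fr: "frame (insert ''i'' (nmods (RAssign x \<beta> nI e))) (amods (RAssign x \<beta> nI e)) s s'"
  from fr have fr': "frame {''i''} {x} s s'" by simp
  show "wp \<omega> (RAssign x \<beta> nI e) s' (\<lambda>k' s''. a + k' = Suc k * (2 + ncost \<beta> + rcost e) \<and>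
      (\<forall>r c. arr (set_nvar ''i'' (Suc k) s'') x r c = (if r = \<rho> \<and> c < Suc k then E c else arr s x r c)))"
    using e[OF fr'] k J row[OF fr'] by (intro wp_RAssign) auto
next
  fix a s'
  assume "a = nvar s ''n'' * (2 + ncost \<beta> + rcost e) \<and>
      (\<forall>r c. arr s' x r c = (if r = \<rho> \<and> c < nvar s ''n'' then E c else arr s x r c))"
    and "frame (insert ''i'' (nmods (RAssign x \<beta> nI e))) (amods (RAssign x \<beta> nI e)) s s'"
  then show "Q (a + nvar s ''n'' * (7 + ncost nN) + (5 + ncost nN)) s'"
    using post[of s'] by (simp add: algebra_simps)
qed (auto simp: frameD)

definition orth_rows :: "nat \<Rightarrow> nat \<Rightarrow> (nat \<Rightarrow> nat \<Rightarrow> real) \<Rightarrow> bool" where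
  "orth_rows n r B \<longleftrightarrow> (\<forall>k<r. \<forall>l<r. k \<noteq> l \<longrightarrow> ip n (B k) (B l) = 0)"

definition rem_comp :: "nat \<Rightarrow> (nat \<Rightarrow> real) \<Rightarrow> (nat \<Rightarrow> real) \<Rightarrow> nat \<Rightarrow> real" where
  "rem_comp n b u = (\<lambda>i. u i - ip n u b / ip n b b * b i)"

text \<open>Since \<open>x / 0 = 0\<close>, rows that vanish need no special treatment.\<close>

lemma ip_rem_comp: "ip n (rem_comp n b u) b = 0"
proof (cases "ip n b b = 0")
  case True
  then have "\<forall>i<n. b i = 0" by (simp add: ip_self_eq_0_iff)
  then show ?thesis by (simp add: ip_def)
next
  case False
  then show ?thesis unfolding rem_comp_def ip_left by simp
qed

text \<open>Used twice: orthogonality to the rows treated before survives the next subtraction, and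
  inner products with vectors orthogonal to all rows never change.\<close>

lemma ip_rem_comp_orth: "ip n b w = 0 \<Longrightarrow> ip n (rem_comp n b u) w = ip n u w"
  unfolding rem_comp_def ip_left by simp

definition ortho :: com where
  "ortho = For ''k'' (NVar ''r'')
    (Seq (dot (RMul (RGet ''u'' n0 nI) (RGet ''b'' (NVar ''k'') nI)) ''a'')
    (Seq (dot (RMul (RGet ''b'' (NVar ''k'') nI) (RGet ''b'' (NVar ''k'') nI)) ''d'')
      (vecset ''u'' n0 (RSub (RGet ''u'' n0 nI)
         (RMul (RDiv (RGet ''a'' n0 n0) (RGet ''d'' n0 n0)) (RGet ''b'' (NVar ''k'') nI))))))"

lemma ortho_mods [simp]:
  "nmods ortho = {''i'', ''k''}" "amods ortho = {''a'', ''d'', ''u''}" "\<not> sampling ortho"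
  by (auto simp: ortho_def)

text \<open>Modified Gram-Schmidt. That the result differs from the old \<open>u\<close> by a
  combination of rows is expressed dually, through inner products with vectors orthogonal to all
  rows. The same code thus serves to extend the orthogonal system and to project a sample.\<close>

lemma wp_ortho:
  assumes n: "n = nvar s ''n''" and B: "B = arr s ''b''" and r: "r = nvar s ''r''"
    and orth: "orth_rows n r B"
    and post: "\<And>s'. \<lbrakk>frame {''i'', ''k''} {''a'', ''d'', ''u''} s s';
        \<And>l. l < r \<Longrightarrow> ip n (arr s' ''u'' 0) (B l) = 0;
        \<And>w. (\<And>l. l < r \<Longrightarrow> ip n (B l) w = 0) \<Longrightarrow> ip n (arr s' ''u'' 0) w = ip n (arr s ''u'' 0) w\<rbrakk> \<Longrightarrow>
      Q (r * (70 * n + 34) + 6) s'"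
  shows "wp \<omega> ortho s Q"
  unfolding ortho_def
\<comment> \<open>Per row: two inner products at \<open>22 * n + 10\<close> each and an update at
  \<open>26 * n + 6\<close>.\<close>
proof (rule wp_For[where N = r and J = "\<lambda>k a s'. a = k * (70 * n + 26) \<and>
      (\<forall>l<k. ip n (arr s' ''u'' 0) (B l) = 0) \<and>
      (\<forall>w. (\<forall>l<r. ip n (B l) w = 0) \<longrightarrow> ip n (arr s' ''u'' 0) w = ip n (arr s ''u'' 0) w)"], goal_cases)
  case 1
  then show ?case by simp
next
  case (2 k a s1)
  then have k: "k < r" "nvar s1 ''k'' = k" and a: "a = k * (70 * n + 26)"
    and old: "\<And>l. l < k \<Longrightarrow> ip n (arr s1 ''u'' 0) (B l) = 0"
    and pres: "\<And>w. (\<And>l. l < r \<Longrightarrow> ip n (B l) w = 0) \<Longrightarrow> ip n (arr s1 ''u'' 0) w = ip n (arr s ''u'' 0) w"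
    and fr1: "frame {''i'', ''k''} {''a'', ''d'', ''u''} s s1" by (auto simp: insert_commute)
  have n1: "nvar s1 ''n'' = n" and B1: "arr s1 ''b'' = B" using fr1 n B by (simp_all add: frameD)
  define u where "u = arr s1 ''u'' 0"
  show ?case
  proof (rule wp_Seq, rule wp_dot[where E = "\<lambda>i. u i * B k i"])
    fix s2 assume fr2: "frame {''i''} {''a''} s1 s2"
      and s2: "arr s2 ''a'' 0 0 = (\<Sum>i<nvar s1 ''n''. u i * B k i)"
    have a2: "arr s2 ''a'' 0 0 = ip n u (B k)" using s2 n1 by (simp add: ip_def)
    have s2': "nvar s2 ''n'' = n" "nvar s2 ''k'' = k" "arr s2 ''b'' = B" "arr s2 ''u'' 0 = u"
      using fr2 n1 B1 k by (simp_all add: frameD u_def)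
    let ?c1 = "nvar s1 ''n'' * (15 + rcost (RMul (RGet ''u'' n0 nI) (RGet ''b'' (NVar ''k'') nI))) + 10"
    let ?Q = "\<lambda>k' s''. a + k' = Suc k * (70 * n + 26) \<and>
      (\<forall>l<Suc k. ip n (arr (set_nvar ''k'' (Suc k) s'') ''u'' 0) (B l) = 0) \<and>
      (\<forall>w. (\<forall>l<r. ip n (B l) w = 0) \<longrightarrow>
         ip n (arr (set_nvar ''k'' (Suc k) s'') ''u'' 0) w = ip n (arr s ''u'' 0) w)"
    show "wp \<omega> (Seq (dot (RMul (RGet ''b'' (NVar ''k'') nI) (RGet ''b'' (NVar ''k'') nI)) ''d'')
      (vecset ''u'' n0 (RSub (RGet ''u'' n0 nI)
         (RMul (RDiv (RGet ''a'' n0 n0) (RGet ''d'' n0 n0)) (RGet ''b'' (NVar ''k'') nI))))) s2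
        (\<lambda>l. ?Q (?c1 + l))"
    proof (rule wp_Seq, rule wp_dot[where E = "\<lambda>i. B k i * B k i"])
      fix s3 assume fr3: "frame {''i''} {''d''} s2 s3"
        and s3: "arr s3 ''d'' 0 0 = (\<Sum>i<nvar s2 ''n''. B k i * B k i)"
      have s3': "arr s3 ''d'' 0 0 = ip n (B k) (B k)" "arr s3 ''a'' 0 0 = ip n u (B k)"
        "nvar s3 ''n'' = n" "nvar s3 ''k'' = k" "arr s3 ''b'' = B" "arr s3 ''u'' 0 = u"
        using fr3 s3 s2' a2 by (simp_all add: frameD ip_def)
      show "wp \<omega> (vecset ''u'' n0 (RSub (RGet ''u'' n0 nI)
         (RMul (RDiv (RGet ''a'' n0 n0) (RGet ''d'' n0 n0)) (RGet ''b'' (NVar ''k'') nI)))) s3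
        (\<lambda>l. ?Q (?c1 + (nvar s2 ''n'' *
           (15 + rcost (RMul (RGet ''b'' (NVar ''k'') nI) (RGet ''b'' (NVar ''k'') nI))) + 10 + l)))"
      proof (rule wp_vecset[where \<rho> = 0 and E = "rem_comp n (B k) u"])
        fix s4 assume fr4: "frame {''i''} {''u''} s3 s4"
          and s4: "\<And>r c. arr s4 ''u'' r c = (if r = 0 \<and> c < nvar s3 ''n'' then rem_comp n (B k) u c else arr s3 ''u'' r c)"
        have u4: "ip n (arr s4 ''u'' 0) w = ip n (rem_comp n (B k) u) w" for w
          by (rule ip_cong) (use s4 s3' in auto)
        have "ip n (rem_comp n (B k) u) (B l) = 0" if "l < Suc k" for l
        proof (cases "l = k")
          case True then show ?thesis by (simp add: ip_rem_comp)
        next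
          case False
          then have "ip n (B k) (B l) = 0" "ip n u (B l) = 0"
            using orth that k(1) old[of l] by (auto simp: orth_rows_def u_def)
          then show ?thesis by (simp add: ip_rem_comp_orth)
        qed
        then show "?Q (?c1 + (nvar s2 ''n'' *
           (15 + rcost (RMul (RGet ''b'' (NVar ''k'') nI) (RGet ''b'' (NVar ''k'') nI))) + 10 +
           (nvar s3 ''n'' * (10 + ncost n0 + rcost (RSub (RGet ''u'' n0 nI)
         (RMul (RDiv (RGet ''a'' n0 n0) (RGet ''d'' n0 n0)) (RGet ''b'' (NVar ''k'') nI)))) + 6))) s4"
          using k(1) a n1 s2' s3' pres by (simp add: u4 ip_rem_comp_orth u_def)
      next
        fix s4 assume fr4: "frame {''i''} {''u''} s3 s4"
          and s4: "\<And>r c. arr s4 ''u'' r c = (if r = 0 \<and> c < nvar s4 ''i'' then rem_comp n (B k) u c else arr s3 ''u'' r c)"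
        show "rval (RSub (RGet ''u'' n0 nI)
         (RMul (RDiv (RGet ''a'' n0 n0) (RGet ''d'' n0 n0)) (RGet ''b'' (NVar ''k'') nI))) s4
            = rem_comp n (B k) u (nvar s4 ''i'')"
          using fr4 s3' by (simp add: frameD s4 rem_comp_def)
      qed simp
    qed (use s2' in \<open>auto simp: frameD\<close>)
  qed (use k B1 in \<open>auto simp: frameD u_def\<close>)
next
  case (5 a s')
  then have "a + r * (7 + ncost (NVar ''r'')) + (5 + ncost (NVar ''r'')) = r * (70 * n + 34) + 6"
    by (simp add: algebra_simps)
  with 5 show ?case by (auto simp: insert_commute intro!: post)
qed (use r in \<open>auto simp: frameD\<close>)

section \<open>The program\<close>

text \<open>Vanishing of a coordinate is orthogonality to a standard basis vector, so one loop can
  treat both kinds of constraint.\<close>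

definition con :: "ew_input \<Rightarrow> nat \<Rightarrow> nat \<Rightarrow> real" where
  "con I j = (if j < num I then vec I j else unit_vec (j - num I))"

definition tight_cons :: "ew_input \<Rightarrow> (nat \<Rightarrow> real) \<Rightarrow> nat set" where
  "tight_cons I x = {j. j < num I + dim I \<and>
     (if j < num I then \<bar>ip (dim I) (\<lambda>i. x i - start I i) (vec I j)\<bar> \<ge> thr I j - slack I
      else \<bar>x (j - num I)\<bar> \<ge> 1 - slack I)}"

lemma tight_eq: "tight_cons I x = C_disc I x \<union> (\<lambda>i. num I + i) ` C_var I x"
proof
  show "tight_cons I x \<subseteq> C_disc I x \<union> (\<lambda>i. num I + i) ` C_var I x"
  proof
    fix j assume j: "j \<in> tight_cons I x"
    show "j \<in> C_disc I x \<union> (\<lambda>i. num I + i) ` C_var I x"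
    proof (cases "j < num I")
      case True
      then show ?thesis using j by (simp add: tight_cons_def C_disc_def)
    next
      case False
      then have "j = num I + (j - num I)" "j - num I \<in> C_var I x"
        using j by (auto simp: tight_cons_def C_var_def)
      then show ?thesis by blast
    qed
  qed
qed (auto simp: tight_cons_def C_disc_def C_var_def)

lemma tight_disc: "tight_cons I x \<inter> {..<num I} = C_disc I x"
  by (auto simp: tight_cons_def C_disc_def)

lemma V_space_iff_con:
  "u \<in> V_space I x \<longleftrightarrow> (\<forall>i\<ge>dim I. u i = 0) \<and> (\<forall>j\<in>tight_cons I x. ip (dim I) u (con I j) = 0)"
proof -
  have "ip (dim I) u (con I j) = ip (dim I) u (vec I j)" if "j \<in> C_disc I x" for j
    using that by (simp add: con_def C_disc_def)
  moreover have "ip (dim I) u (con I (num I + i)) = u i" if "i \<in> C_var I x" for i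
    using that by (simp add: con_def C_var_def ip_unit_vec)
  ultimately show ?thesis by (auto simp: V_space_def tight_eq)
qed

lemma tight_mono:
  assumes u: "u \<in> V_space I x"
  shows "tight_cons I x \<subseteq> tight_cons I (\<lambda>i. x i + c * u i)"
proof
  fix j assume j: "j \<in> tight_cons I x"
  have "ip (dim I) (\<lambda>i. x i + c * u i - start I i) (vec I j) = ip (dim I) (\<lambda>i. x i - start I i) (vec I j)"
    if "j < num I"
  proof -
    have "ip (dim I) u (vec I j) = 0" using u j that by (auto simp: V_space_def simp flip: tight_disc)
    then show ?thesis by (simp add: ip_left)
  qed
  moreover have "u (j - num I) = 0" if "\<not> j < num I"
    using u j that by (auto simp: V_space_def tight_cons_def C_var_def)
  ultimately show "j \<in> tight_cons I (\<lambda>i. x i + c * u i)" using j by (auto simp: tight_cons_def)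
qed

text \<open>Equality of orthogonal complements instead of spans: this is what the projection needs,
  and redundant constraints with their zero rows fit in.\<close>

definition rows_ok :: "ew_input \<Rightarrow> nat set \<Rightarrow> nat \<Rightarrow> (nat \<Rightarrow> nat \<Rightarrow> real) \<Rightarrow> bool" where
  "rows_ok I F r B \<longleftrightarrow> orth_rows (dim I) r B \<and>
     (\<forall>u. (\<forall>k<r. ip (dim I) u (B k) = 0) \<longleftrightarrow> (\<forall>j\<in>F. ip (dim I) u (con I j) = 0))"

text \<open>On vectors orthogonal to the earlier rows, the new row and the new constraint have the
  same inner products, so either may be used to cut the complement down.\<close>

lemma rows_ok_insert:
  assumes ok: "rows_ok I F r B" and B': "\<And>k. k < r \<Longrightarrow> B' k = B k"
    and orth: "\<And>l. l < r \<Longrightarrow> ip (dim I) (B' r) (B l) = 0"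
    and pres: "\<And>w. (\<And>l. l < r \<Longrightarrow> ip (dim I) (B l) w = 0) \<Longrightarrow> ip (dim I) (B' r) w = ip (dim I) (con I j) w"
  shows "rows_ok I (insert j F) (Suc r) B'"
proof -
  have "ip (dim I) (B l) (B' r) = 0" if "l < r" for l
    using orth[OF that] by (subst ip_commute)
  then have "orth_rows (dim I) (Suc r) B'"
    using ok orth B' by (auto simp: rows_ok_def orth_rows_def less_Suc_eq)
  moreover have "(\<forall>k<Suc r. ip (dim I) u (B' k) = 0) \<longleftrightarrow> (\<forall>j\<in>insert j F. ip (dim I) u (con I j) = 0)" for u
  proof -
    have "(\<forall>k<Suc r. ip (dim I) u (B' k) = 0) \<longleftrightarrow> (\<forall>k<r. ip (dim I) u (B k) = 0) \<and> ip (dim I) u (B' r) = 0"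
      using B' by (auto simp: less_Suc_eq)
    also have "\<dots> \<longleftrightarrow> (\<forall>k<r. ip (dim I) u (B k) = 0) \<and> ip (dim I) u (con I j) = 0"
      using pres[of u] by (auto simp: ip_commute[of _ _ u])
    also have "\<dots> \<longleftrightarrow> (\<forall>j\<in>insert j F. ip (dim I) u (con I j) = 0)"
      using ok by (auto simp: rows_ok_def)
    finally show ?thesis .
  qed
  ultimately show ?thesis by (simp add: rows_ok_def)
qed

definition inputs_ok :: "ew_input \<Rightarrow> store \<Rightarrow> bool" where
  "inputs_ok I s \<longleftrightarrow> nvar s ''n'' = dim I \<and> nvar s ''m'' = num I \<and> nvar s ''T'' = iters I \<and>
     (\<forall>j<num I. \<forall>i<dim I. arr s ''v'' j i = vec I j i) \<and> (\<forall>j<num I. arr s ''c'' 0 j = thr I j) \<and>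
     (\<forall>i<dim I. arr s ''x'' 0 i = start I i) \<and> arr s ''delta'' 0 0 = slack I \<and> arr s ''gamma'' 0 0 = stepsize I"

lemma inputs_ok_frame:
  "\<lbrakk>inputs_ok I s; frame N A s s'; N \<inter> {''n'', ''m'', ''T''} = {};
    A \<inter> {''v'', ''c'', ''x'', ''delta'', ''gamma''} = {}\<rbrakk> \<Longrightarrow> inputs_ok I s'"
  unfolding inputs_ok_def frame_def by auto

text \<open>
  Constraint \<open>j\<close> with \<open>j < num I\<close> is a discrepancy constraint, \<open>num I + i\<close> is the one of coordinate \<open>i\<close>.
  In the program, \<open>z\<close> marks the constraints that were ever tight, \<open>q\<close> counts the marked discrepancy
  constraints, and the first \<open>r\<close> rows of \<open>b\<close> are orthogonal vectors with the same orthogonal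
  complement as the marked constraints. The arrays \<open>a\<close>, \<open>d\<close> and \<open>u\<close> are scratch space.
\<close>

abbreviation nJ where "nJ \<equiv> NVar ''j''"
abbreviation nM where "nM \<equiv> NVar ''m''"
abbreviation nR where "nR \<equiv> NVar ''r''"
abbreviation nQ where "nQ \<equiv> NVar ''q''"
abbreviation nTau where "nTau \<equiv> NVar ''tau''"
abbreviation n1 where "n1 \<equiv> NConst 1"

section \<open>Extending the orthogonal system by one constraint\<close>

definition load :: com where
  "load = Cond (NLess nJ nM) (vecset ''u'' n0 (RGet ''v'' nJ nI))
     (Seq (vecset ''u'' n0 (RConst 0)) (RAssign ''u'' n0 (NSub nJ nM) (RConst 1)))"

lemma load_mods [simp]: "nmods load = {''i''}" "amods load = {''u''}" "\<not> sampling load"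
  by (auto simp: load_def)

lemma wp_load:
  assumes I: "inputs_ok I s" and j: "nvar s ''j'' = j" "j < num I + dim I"
    and post: "\<And>k s'. \<lbrakk>frame {''i''} {''u''} s s'; \<And>i. i < dim I \<Longrightarrow> arr s' ''u'' 0 i = con I j i;
      k \<le> 14 * dim I + 16\<rbrakk> \<Longrightarrow> Q k s'"
  shows "wp \<omega> load s Q"
proof -
  have n: "nvar s ''n'' = dim I" and m: "nvar s ''m'' = num I" using I by (auto simp: inputs_ok_def)
  show ?thesis
    unfolding load_def
  proof (rule wp_Cond)
    assume "bval (NLess nJ nM) s"
    then have jm: "j < num I" using j m by simp
    show "wp \<omega> (vecset ''u'' n0 (RGet ''v'' nJ nI)) s (\<lambda>k. Q (1 + bcost (NLess nJ nM) + k))"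
    proof (rule wp_vecset[where \<rho> = 0 and E = "con I j"])
      fix s' assume "frame {''i''} {''u''} s s'" "nvar s' ''i'' < nvar s ''n''"
      then show "rval (RGet ''v'' nJ nI) s' = con I j (nvar s' ''i'')"
        using I j jm n by (simp add: frameD inputs_ok_def con_def)
    next
      fix s' assume "frame {''i''} {''u''} s s'"
        "\<And>r c. arr s' ''u'' r c = (if r = 0 \<and> c < nvar s ''n'' then con I j c else arr s ''u'' r c)"
      then show "Q (1 + bcost (NLess nJ nM) + (nvar s ''n'' * (10 + ncost n0 + rcost (RGet ''v'' nJ nI)) + 6)) s'"
        using n by (intro post) auto
    qed simp
  next
    assume "\<not> bval (NLess nJ nM) s"
    then have jm: "\<not> j < num I" using j m by simp
    show "wp \<omega> (Seq (vecset ''u'' n0 (RConst 0)) (RAssign ''u'' n0 (NSub nJ nM) (RConst 1))) s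
        (\<lambda>k. Q (1 + bcost (NLess nJ nM) + k))"
    proof (rule wp_Seq, rule wp_vecset[where \<rho> = 0 and E = "\<lambda>_. 0"], simp, simp, rule wp_RAssign)
      fix s' assume fr: "frame {''i''} {''u''} s s'"
        and s': "\<And>r c. arr s' ''u'' r c = (if r = 0 \<and> c < nvar s ''n'' then 0 else arr s ''u'' r c)"
      let ?s = "set_arr ''u'' (nval n0 s') (nval (NSub nJ nM) s') (rval (RConst 1) s') s'"
      have "frame {''i''} {''u''} s ?s" using fr by (simp add: frame_def)
      moreover have "arr ?s ''u'' 0 i = con I j i" if "i < dim I" for i
        using that fr s' n j m jm by (simp add: frameD con_def unit_vec_def)
      ultimately show "Q (1 + bcost (NLess nJ nM) + (nvar s ''n'' * (10 + ncost n0 + rcost (RConst 0)) + 6 +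
          (1 + ncost n0 + ncost (NSub nJ nM) + rcost (RConst 1)))) ?s"
        using n by (intro post) auto
    qed
  qed
qed

definition ins :: com where
  "ins = Seq load (Seq ortho (Seq (vecset ''b'' nR (RGet ''u'' n0 nI)) (NAssign ''r'' (NAdd nR n1))))"

lemma ins_mods [simp]:
  "nmods ins = {''i'', ''k'', ''r''}" "amods ins = {''a'', ''b'', ''d'', ''u''}" "\<not> sampling ins"
  by (auto simp: ins_def)

lemma wp_ins:
  assumes I: "inputs_ok I s" and j: "nvar s ''j'' = j" "j < num I + dim I"
    and r: "nvar s ''r'' = r" and ok: "rows_ok I F r (arr s ''b'')"
    and post: "\<And>k s'. \<lbrakk>frame {''i'', ''k'', ''r''} {''a'', ''b'', ''d'', ''u''} s s'; nvar s' ''r'' = Suc r;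
      rows_ok I (insert j F) (Suc r) (arr s' ''b'');
      k \<le> 28 * dim I + 32 + r * (70 * dim I + 34)\<rbrakk> \<Longrightarrow> Q k s'"
  shows "wp \<omega> ins s Q"
  unfolding ins_def
proof (rule wp_Seq, rule wp_load[OF I j], rule wp_Seq)
  let ?n = "dim I" and ?B = "arr s ''b''"
  fix k1 s1
  assume fr1: "frame {''i''} {''u''} s s1" and u1: "\<And>i. i < ?n \<Longrightarrow> arr s1 ''u'' 0 i = con I j i"
    and k1: "k1 \<le> 14 * ?n + 16"
  have n1: "nvar s1 ''n'' = ?n" using I fr1 by (simp add: inputs_ok_def frameD)
  show "wp \<omega> ortho s1 (\<lambda>k s'. wp \<omega> (Seq (vecset ''b'' nR (RGet ''u'' n0 nI)) (NAssign ''r'' (NAdd nR n1))) s'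
      (\<lambda>l. Q (k1 + (k + l))))"
  proof (rule wp_ortho[where n = ?n and B = ?B and r = r], goal_cases)
    case (5 s2)
    then have fr2: "frame {''i'', ''k''} {''a'', ''d'', ''u''} s1 s2"
      and orth2: "\<And>l. l < r \<Longrightarrow> ip ?n (arr s2 ''u'' 0) (?B l) = 0"
      and pres2: "\<And>w. (\<And>l. l < r \<Longrightarrow> ip ?n (?B l) w = 0) \<Longrightarrow> ip ?n (arr s2 ''u'' 0) w = ip ?n (arr s1 ''u'' 0) w"
      by blast+
    have s2: "nvar s2 ''n'' = ?n" "nvar s2 ''r'' = r" "arr s2 ''b'' = ?B"
      using fr1 fr2 n1 r by (simp_all add: frameD)
    show ?case
    proof (rule wp_Seq, rule wp_vecset[where \<rho> = r and E = "arr s2 ''u'' 0"], goal_cases)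
      case (3 s3)
      then have fr3: "frame {''i''} {''b''} s2 s3"
        and b3: "\<And>r' c. arr s3 ''b'' r' c = (if r' = r \<and> c < ?n then arr s2 ''u'' 0 c else ?B r' c)"
        using s2 by auto
      let ?s = "set_nvar ''r'' (nval (NAdd nR n1) s3) s3"
      have "frame {''i'', ''k'', ''r''} {''a'', ''b'', ''d'', ''u''} s ?s"
        using fr1 fr2 fr3 by (simp add: frame_def)
      moreover have "nvar ?s ''r'' = Suc r" using fr3 s2 by (simp add: frameD)
      moreover have "rows_ok I (insert j F) (Suc r) (arr s3 ''b'')"
      proof (rule rows_ok_insert[OF ok])
        show "arr s3 ''b'' k = ?B k" if "k < r" for k using b3 that by auto
        have b: "ip ?n (arr s3 ''b'' r) w = ip ?n (arr s2 ''u'' 0) w" for w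
          by (rule ip_cong) (use b3 in auto)
        show "ip ?n (arr s3 ''b'' r) (?B l) = 0" if "l < r" for l using orth2[OF that] by (simp add: b)
        have "ip ?n (arr s1 ''u'' 0) w = ip ?n (con I j) w" for w
          by (rule ip_cong) (use u1 in auto)
        then show "ip ?n (arr s3 ''b'' r) w = ip ?n (con I j) w" if "\<And>l. l < r \<Longrightarrow> ip ?n (?B l) w = 0" for w
          using pres2[OF that] by (simp add: b)
      qed
      ultimately show ?case using s2 k1 by (intro wp_NAssign post) (auto simp: algebra_simps)
    qed (use s2 in \<open>auto simp: frameD\<close>)
  qed (use n1 fr1 r ok in \<open>auto simp: frameD rows_ok_def\<close>)
qed

section \<open>Finding the tight constraints\<close>

definition gap :: com where
  "gap = Cond (NLess nJ nM)
     (Seq (dot (RMul (RSub (RGet ''X'' nTau nI) (RGet ''x'' n0 nI)) (RGet ''v'' nJ nI)) ''a'')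
        (RAssign ''d'' n0 n0 (RSub (RGet ''c'' n0 nJ) (RGet ''delta'' n0 n0))))
     (Seq (RAssign ''a'' n0 n0 (RGet ''X'' nTau (NSub nJ nM)))
        (RAssign ''d'' n0 n0 (RSub (RConst 1) (RGet ''delta'' n0 n0))))"

text \<open>With strict comparison as the only primitive and no absolute value, the non-strict test
  is the negation of two strict ones.\<close>

definition tight_test :: bexp where
  "tight_test = BNot (BAnd (RLess (RGet ''a'' n0 n0) (RGet ''d'' n0 n0))
     (RLess (RSub (RConst 0) (RGet ''a'' n0 n0)) (RGet ''d'' n0 n0)))"

lemma bval_tight_test: "bval tight_test s \<longleftrightarrow> \<bar>arr s ''a'' 0 0\<bar> \<ge> arr s ''d'' 0 0"
  by (auto simp: tight_test_def)

lemma gap_mods [simp]: "nmods gap = {''i''}" "amods gap = {''a'', ''d''}" "\<not> sampling gap"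
  by (auto simp: gap_def)

lemma wp_gap:
  assumes I: "inputs_ok I s" and j: "nvar s ''j'' = j" "j < num I + dim I"
    and x: "\<And>i. i < dim I \<Longrightarrow> arr s ''X'' (nvar s ''tau'') i = x i"
    and post: "\<And>k s'. \<lbrakk>frame {''i''} {''a'', ''d''} s s'; bval tight_test s' \<longleftrightarrow> j \<in> tight_cons I x;
      k \<le> 26 * dim I + 24\<rbrakk> \<Longrightarrow> Q k s'"
  shows "wp \<omega> gap s Q"
proof -
  have n: "nvar s ''n'' = dim I" and m: "nvar s ''m'' = num I" using I by (auto simp: inputs_ok_def)
  show ?thesis
    unfolding gap_def
  proof (rule wp_Cond)
    assume "bval (NLess nJ nM) s"
    then have jm: "j < num I" using j m by simp
    show "wp \<omega> (Seq (dot (RMul (RSub (RGet ''X'' nTau nI) (RGet ''x'' n0 nI)) (RGet ''v'' nJ nI)) ''a'')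
        (RAssign ''d'' n0 n0 (RSub (RGet ''c'' n0 nJ) (RGet ''delta'' n0 n0)))) s
      (\<lambda>k. Q (1 + bcost (NLess nJ nM) + k))"
    proof (rule wp_Seq, rule wp_dot[where E = "\<lambda>i. (x i - start I i) * vec I j i"])
      fix s' assume "frame {''i''} {''a''} s s'" "nvar s' ''i'' < nvar s ''n''"
      then show "rval (RMul (RSub (RGet ''X'' nTau nI) (RGet ''x'' n0 nI)) (RGet ''v'' nJ nI)) s'
          = (x (nvar s' ''i'') - start I (nvar s' ''i'')) * vec I j (nvar s' ''i'')"
        using I j jm n x by (simp add: frameD inputs_ok_def)
    next
      fix s' assume fr: "frame {''i''} {''a''} s s'"
        and a: "arr s' ''a'' 0 0 = (\<Sum>i<nvar s ''n''. (x i - start I i) * vec I j i)"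
      have "arr s' ''c'' 0 j = thr I j" "arr s' ''delta'' 0 0 = slack I" "nvar s' ''j'' = j"
        using fr I j jm by (simp_all add: frameD inputs_ok_def)
      then show "wp \<omega> (RAssign ''d'' n0 n0 (RSub (RGet ''c'' n0 nJ) (RGet ''delta'' n0 n0))) s'
        (\<lambda>l. Q (1 + bcost (NLess nJ nM) + (nvar s ''n'' * (15 + rcost (RMul (RSub (RGet ''X'' nTau nI) (RGet ''x'' n0 nI)) (RGet ''v'' nJ nI))) + 10 + l)))"
        using fr a n jm
        by (intro wp_RAssign post) (auto simp: frame_def bval_tight_test tight_cons_def ip_def)
    qed
  next
    assume "\<not> bval (NLess nJ nM) s"
    then have jm: "\<not> j < num I" using j m by simp
    have "arr s ''X'' (nvar s ''tau'') (j - num I) = x (j - num I)" "arr s ''delta'' 0 0 = slack I"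
      using I j jm by (auto intro!: x simp: inputs_ok_def)
    then show "wp \<omega> (Seq (RAssign ''a'' n0 n0 (RGet ''X'' nTau (NSub nJ nM)))
        (RAssign ''d'' n0 n0 (RSub (RConst 1) (RGet ''delta'' n0 n0)))) s
      (\<lambda>k. Q (1 + bcost (NLess nJ nM) + k))"
      using j m jm
      by (intro wp_Seq wp_RAssign post) (auto simp: frame_def bval_tight_test tight_cons_def)
  qed
qed

text \<open>Once \<open>q\<close> reaches the dimension the procedure is going to fail and the rows
  are no longer maintained; only the bound on their number, which the time analysis needs, continues
  to hold.\<close>

definition scan_inv :: "ew_input \<Rightarrow> nat set \<Rightarrow> store \<Rightarrow> bool" where
  "scan_inv I F s \<longleftrightarrow> F \<subseteq> {..<num I + dim I} \<and>
     (\<forall>j<num I + dim I. arr s ''z'' 0 j = (if j \<in> F then 1 else 0)) \<and>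
     nvar s ''q'' = card (F \<inter> {..<num I}) \<and> nvar s ''r'' \<le> 2 * dim I \<and>
     (nvar s ''q'' < dim I \<longrightarrow> nvar s ''r'' = card F \<and> rows_ok I F (nvar s ''r'') (arr s ''b''))"

lemma scan_inv_cong:
  "\<lbrakk>nvar s' ''q'' = nvar s ''q''; nvar s' ''r'' = nvar s ''r''; arr s' ''z'' = arr s ''z''; arr s' ''b'' = arr s ''b''\<rbrakk>
   \<Longrightarrow> scan_inv I F s' = scan_inv I F s"
  unfolding scan_inv_def by (simp only:)

definition flag :: com where
  "flag = Seq (RAssign ''z'' n0 nJ (RConst 1)) (Cond (NLess nJ nM) (NAssign ''q'' (NAdd nQ n1)) Skip)"

lemma flag_mods [simp]: "nmods flag = {''q''}" "amods flag = {''z''}" "\<not> sampling flag"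
  by (auto simp: flag_def)

lemma wp_flag:
  assumes "nvar s ''j'' = j" "nvar s ''m'' = m"
    and post: "\<And>k s'. \<lbrakk>frame {''q''} {''z''} s s'; k \<le> 12;
      nvar s' ''q'' = nvar s ''q'' + (if j < m then 1 else 0);
      \<And>l. arr s' ''z'' 0 l = (if l = j then 1 else arr s ''z'' 0 l)\<rbrakk> \<Longrightarrow> Q k s'"
  shows "wp \<omega> flag s Q"
  unfolding flag_def
  by (intro wp_Seq wp_RAssign wp_Cond wp_NAssign wp_Skip; rule post)
    (use assms(1,2) in \<open>auto simp: frame_def\<close>)

text \<open>The test of \<open>q\<close> follows the marking, so the discrepancy constraint that
  brings \<open>q\<close> up to the dimension is marked but no longer orthogonalised.\<close>

definition scan_body :: com where
  "scan_body = Cond (RLess (RGet ''z'' n0 nJ) (RConst 1))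
     (Seq gap (Cond tight_test (Seq flag (Cond (NLess nQ nN) ins Skip)) Skip)) Skip"

lemma scan_body_mods [simp]:
  "nmods scan_body = {''i'', ''k'', ''q'', ''r''}" "amods scan_body = {''a'', ''b'', ''d'', ''u'', ''z''}"
  "\<not> sampling scan_body"
  by (auto simp: scan_body_def)

lemma card_flags_insert:
  fixes F :: "nat set"
  assumes "F \<subseteq> {..<m + n}" "j \<notin> F"
  shows "card (insert j F \<inter> {..<m}) = card (F \<inter> {..<m}) + (if j < m then 1 else 0)"
    and "card (insert j F) = Suc (card F)"
proof -
  have fin: "finite F" using assms(1) by (rule finite_subset) simp
  have "insert j F \<inter> {..<m} = (if j < m then insert j (F \<inter> {..<m}) else F \<inter> {..<m})" by auto
  then show "card (insert j F \<inter> {..<m}) = card (F \<inter> {..<m}) + (if j < m then 1 else 0)"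
    using assms(2) fin by simp
  show "card (insert j F) = Suc (card F)" using assms(2) fin by simp
qed

text \<open>The source of the bound on the rows: if fewer than \<open>n\<close> discrepancy
  constraints are marked, then fewer than \<open>2 * n\<close> constraints are marked
  altogether.\<close>

lemma card_flags_le:
  assumes "F \<subseteq> {..<m + n}"
  shows "card F \<le> card (F \<inter> {..<m}) + (n::nat)"
proof -
  have "card F \<le> card ((F \<inter> {..<m}) \<union> {m..<m + n})" using assms by (intro card_mono) auto
  also have "\<dots> \<le> card (F \<inter> {..<m}) + card {m..<m + n}" by (rule card_Un_le)
  finally show ?thesis by simp
qed

text \<open>Since \<open>n\<close> is at least 1, a row costs at most \<open>104 * n\<close>, and
  208 is twice 104.\<close>

lemma row_cost:
  assumes "1 \<le> (n::nat)" "r \<le> 2 * n"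
  shows "r * (70 * n + 34) \<le> 208 * n\<^sup>2"
proof -
  have "r * (70 * n + 34) \<le> (2 * n) * (104 * n)" using assms by (intro mult_mono) auto
  then show ?thesis by (simp add: power2_eq_square)
qed

text \<open>Amortised cost: each new row brings a credit of 268 times the squared dimension, namely
  208 for the orthogonalisation and 60 for the linear rest \<open>28 * n + 32\<close> of
  \<open>ins\<close>. Everything else costs at most \<open>26 * n + 66\<close>, hence at most
  \<open>92 * n\<close>.\<close>

lemma wp_scan_body:
  assumes I: "inputs_ok I s" and dim: "dim I \<ge> 1" and j: "nvar s ''j'' = j" "j < num I + dim I"
    and x: "\<And>i. i < dim I \<Longrightarrow> arr s ''X'' (nvar s ''tau'') i = x i" and F: "scan_inv I F s"
    and post: "\<And>k s'. \<lbrakk>frame {''i'', ''k'', ''q'', ''r''} {''a'', ''b'', ''d'', ''u'', ''z''} s s';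
      scan_inv I (F \<union> ({j} \<inter> tight_cons I x)) s';
      k + nvar s ''r'' * (268 * (dim I)\<^sup>2) \<le> 92 * dim I + nvar s' ''r'' * (268 * (dim I)\<^sup>2)\<rbrakk> \<Longrightarrow> Q k s'"
  shows "wp \<omega> scan_body s Q"
  unfolding scan_body_def
proof (rule wp_Cond)
  assume "\<not> bval (RLess (RGet ''z'' n0 nJ) (RConst 1)) s"
  then have "j \<in> F" using F j by (auto simp: scan_inv_def split: if_splits)
  then have "F \<union> ({j} \<inter> tight_cons I x) = F" by auto
  then show "wp \<omega> Skip s (\<lambda>k. Q (1 + bcost (RLess (RGet ''z'' n0 nJ) (RConst 1)) + k))"
    using F dim by (intro wp_Skip post) (auto simp: frame_refl)
next
  let ?n = "dim I" and ?m = "num I"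
  assume "bval (RLess (RGet ''z'' n0 nJ) (RConst 1)) s"
  then have jF: "j \<notin> F" using F j by (auto simp: scan_inv_def)
  have FF: "F \<subseteq> {..<?m + ?n}" using F by (simp add: scan_inv_def)
  show "wp \<omega> (Seq gap (Cond tight_test (Seq flag (Cond (NLess nQ nN) ins Skip)) Skip)) s
      (\<lambda>k. Q (1 + bcost (RLess (RGet ''z'' n0 nJ) (RConst 1)) + k))"
  proof (rule wp_Seq, rule wp_gap[OF I j x], assumption, rule wp_Cond)
    fix k1 s1
    assume fr1: "frame {''i''} {''a'', ''d''} s s1" and tt: "bval tight_test s1 \<longleftrightarrow> j \<in> tight_cons I x"
      and k1: "k1 \<le> 26 * ?n + 24" and "\<not> bval tight_test s1"
    then have "F \<union> ({j} \<inter> tight_cons I x) = F" by auto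
    moreover have "scan_inv I F s1" using F fr1 by (subst scan_inv_cong[of _ s]) (simp_all add: frameD)
    moreover have "frame {''i'', ''k'', ''q'', ''r''} {''a'', ''b'', ''d'', ''u'', ''z''} s s1"
      using fr1 by (rule frame_mono) auto
    ultimately show "wp \<omega> Skip s1 (\<lambda>k. Q (1 + bcost (RLess (RGet ''z'' n0 nJ) (RConst 1)) + (k1 + (1 + bcost tight_test + k))))"
      using k1 fr1 dim by (intro wp_Skip post) (auto simp: frameD tight_test_def)
  next
    fix k1 s1
    assume fr1: "frame {''i''} {''a'', ''d''} s s1" and tt: "bval tight_test s1 \<longleftrightarrow> j \<in> tight_cons I x"
      and k1: "k1 \<le> 26 * ?n + 24" and "bval tight_test s1"
    then have F': "F \<union> ({j} \<inter> tight_cons I x) = insert j F" by auto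
    have s1: "nvar s1 ''j'' = j" "nvar s1 ''m'' = ?m" using fr1 j I by (simp_all add: frameD inputs_ok_def)
    show "wp \<omega> (Seq flag (Cond (NLess nQ nN) ins Skip)) s1
      (\<lambda>k. Q (1 + bcost (RLess (RGet ''z'' n0 nJ) (RConst 1)) + (k1 + (1 + bcost tight_test + k))))"
    proof (rule wp_Seq, rule wp_flag[OF s1])
      fix k2 :: nat and s2
      assume fr2: "frame {''q''} {''z''} s1 s2" and k2: "k2 \<le> 12"
        and q2: "nvar s2 ''q'' = nvar s1 ''q'' + (if j < ?m then 1 else 0)"
        and z2: "\<And>l. arr s2 ''z'' 0 l = (if l = j then 1 else arr s1 ''z'' 0 l)"
      have fr12: "frame {''i'', ''q''} {''a'', ''d'', ''z''} s s2"
        by (rule frame_trans[OF fr1 fr2]) auto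
      have I2: "inputs_ok I s2" by (rule inputs_ok_frame[OF I fr12]) auto
      have j2: "nvar s2 ''j'' = j" using fr12 j by (simp add: frameD)
      have q2': "nvar s2 ''q'' = card (insert j F \<inter> {..<?m})"
        using F fr1 q2 card_flags_insert(1)[OF FF jF] by (simp add: frameD scan_inv_def)
      have z2': "arr s2 ''z'' 0 l = (if l \<in> insert j F then 1 else 0)" if "l < ?m + ?n" for l
        using F fr1 that by (auto simp: z2 frameD scan_inv_def)
      have r2: "nvar s2 ''r'' = nvar s ''r''" "arr s2 ''b'' = arr s ''b''" using fr12 by (simp_all add: frameD)
      have n2: "nvar s2 ''n'' = ?n" using I2 by (simp add: inputs_ok_def)
      show "wp \<omega> (Cond (NLess nQ nN) ins Skip) s2
        (\<lambda>l. Q (1 + bcost (RLess (RGet ''z'' n0 nJ) (RConst 1)) + (k1 + (1 + bcost tight_test + (k2 + l)))))"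
      proof (rule wp_Cond)
        assume "\<not> bval (NLess nQ nN) s2"
        then have "scan_inv I (insert j F) s2"
          using F FF j q2' z2' r2 n2 by (simp add: scan_inv_def)
        moreover have "frame {''i'', ''k'', ''q'', ''r''} {''a'', ''b'', ''d'', ''u'', ''z''} s s2"
          using fr12 by (rule frame_mono) auto
        ultimately show "wp \<omega> Skip s2 (\<lambda>k. Q (1 + bcost (RLess (RGet ''z'' n0 nJ) (RConst 1)) +
            (k1 + (1 + bcost tight_test + (k2 + (1 + bcost (NLess nQ nN) + k))))))"
          using k1 k2 r2 dim by (intro wp_Skip post) (auto simp: F' tight_test_def)
      next
        assume "bval (NLess nQ nN) s2"
        then have qn: "nvar s2 ''q'' < ?n" using n2 by simp
        define r where "r = nvar s ''r''"
        have "nvar s ''q'' < ?n" using qn q2 fr1 by (auto simp: frameD split: if_splits)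
        then have rF: "r = card F" and ok: "rows_ok I F r (arr s2 ''b'')"
          using F r2 unfolding scan_inv_def r_def by auto
        have "insert j F \<subseteq> {..<?m + ?n}" using FF j by simp
        from card_flags_le[OF this] have rr: "Suc r \<le> 2 * ?n"
          using qn q2' rF card_flags_insert(2)[OF FF jF] by simp
        show "wp \<omega> ins s2 (\<lambda>k. Q (1 + bcost (RLess (RGet ''z'' n0 nJ) (RConst 1)) +
            (k1 + (1 + bcost tight_test + (k2 + (1 + bcost (NLess nQ nN) + k))))))"
        proof (rule wp_ins[OF I2 j2 j(2) _ ok])
          show "nvar s2 ''r'' = r" by (simp add: r2 r_def)
          fix k3 s3
          assume fr3: "frame {''i'', ''k'', ''r''} {''a'', ''b'', ''d'', ''u''} s2 s3"
            and r3: "nvar s3 ''r'' = Suc r" and ok3: "rows_ok I (insert j F) (Suc r) (arr s3 ''b'')"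
            and k3: "k3 \<le> 28 * ?n + 32 + r * (70 * ?n + 34)"
          have "frame {''i'', ''k'', ''q'', ''r''} {''a'', ''b'', ''d'', ''u'', ''z''} s s3"
            by (rule frame_trans[OF fr12 fr3]) auto
          moreover have "scan_inv I (insert j F) s3"
            using FF j q2' z2' fr3 r3 ok3 rr rF card_flags_insert(2)[OF FF jF]
            by (simp add: scan_inv_def frameD)
          moreover have "k3 \<le> 268 * ?n\<^sup>2"
          proof -
            have "r * (70 * ?n + 34) \<le> 208 * ?n\<^sup>2" using dim rr by (intro row_cost) auto
            moreover have "28 * ?n + 32 \<le> 60 * ?n\<^sup>2"
              using dim self_le_power[of ?n 2] by simp
            ultimately show ?thesis using k3 by linarith
          qed
          ultimately show "Q (1 + bcost (RLess (RGet ''z'' n0 nJ) (RConst 1)) +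
            (k1 + (1 + bcost tight_test + (k2 + (1 + bcost (NLess nQ nN) + k3))))) s3"
            using k1 k2 dim r3 by (intro post) (auto simp: F' tight_test_def r_def)
        qed
      qed
    qed
  qed
qed

definition scan :: com where
  "scan = For ''j'' (NAdd nM nN) scan_body"

lemma scan_mods [simp]:
  "nmods scan = {''i'', ''j'', ''k'', ''q'', ''r''}" "amods scan = {''a'', ''b'', ''d'', ''u'', ''z''}"
  "\<not> sampling scan"
  by (auto simp: scan_def)

lemma wp_scan:
  assumes I: "inputs_ok I s" and dim: "dim I \<ge> 1"
    and x: "\<And>i. i < dim I \<Longrightarrow> arr s ''X'' (nvar s ''tau'') i = x i" and F: "scan_inv I F s"
    and post: "\<And>k s'. \<lbrakk>frame {''i'', ''j'', ''k'', ''q'', ''r''} {''a'', ''b'', ''d'', ''u'', ''z''} s s';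
      scan_inv I (F \<union> tight_cons I x) s';
      k + nvar s ''r'' * (268 * (dim I)\<^sup>2) \<le> (num I + dim I) * (102 * dim I) + 8 + nvar s' ''r'' * (268 * (dim I)\<^sup>2)\<rbrakk>
      \<Longrightarrow> Q k s'"
  shows "wp \<omega> scan s Q"
  unfolding scan_def
proof (rule wp_For[where N = "num I + dim I" and J = "\<lambda>k a s'. scan_inv I (F \<union> ({..<k} \<inter> tight_cons I x)) s' \<and>
      a + nvar s ''r'' * (268 * (dim I)\<^sup>2) \<le> k * (92 * dim I) + nvar s' ''r'' * (268 * (dim I)\<^sup>2)"], goal_cases)
  case 1
  then show ?case using F by (simp add: scan_inv_cong[of "set_nvar ''j'' 0 s" s])
next
  case (2 k a s1)
  then have fr1: "frame {''i'', ''j'', ''k'', ''q'', ''r''} {''a'', ''b'', ''d'', ''u'', ''z''} s s1"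
    by (auto intro: frame_mono)
  have I1: "inputs_ok I s1" by (rule inputs_ok_frame[OF I fr1]) auto
  have x1: "arr s1 ''X'' (nvar s1 ''tau'') i = x i" if "i < dim I" for i
    using fr1 x[OF that] by (simp add: frameD)
  from 2 have k: "k < num I + dim I" "nvar s1 ''j'' = k"
    and inv: "scan_inv I (F \<union> ({..<k} \<inter> tight_cons I x)) s1"
    and a: "a + nvar s ''r'' * (268 * (dim I)\<^sup>2) \<le> k * (92 * dim I) + nvar s1 ''r'' * (268 * (dim I)\<^sup>2)" by auto
  show ?case
  proof (rule wp_scan_body[OF I1 dim k(2,1) x1 inv], assumption)
    fix k' s2
    assume inv2: "scan_inv I (F \<union> ({..<k} \<inter> tight_cons I x) \<union> ({k} \<inter> tight_cons I x)) s2"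
      and k': "k' + nvar s1 ''r'' * (268 * (dim I)\<^sup>2) \<le> 92 * dim I + nvar s2 ''r'' * (268 * (dim I)\<^sup>2)"
    have "F \<union> ({..<k} \<inter> tight_cons I x) \<union> ({k} \<inter> tight_cons I x) = F \<union> ({..<Suc k} \<inter> tight_cons I x)"
      by (auto simp: less_Suc_eq)
    then show "scan_inv I (F \<union> ({..<Suc k} \<inter> tight_cons I x)) (set_nvar ''j'' (Suc k) s2) \<and>
      a + k' + nvar s ''r'' * (268 * (dim I)\<^sup>2)
        \<le> Suc k * (92 * dim I) + nvar (set_nvar ''j'' (Suc k) s2) ''r'' * (268 * (dim I)\<^sup>2)"
      using inv2 k' a by (simp add: scan_inv_cong[of "set_nvar ''j'' (Suc k) s2" s2])
  qed
next
  case 3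
  then show ?case by simp
next
  case (4 s')
  then show ?case using I by (simp add: frameD inputs_ok_def)
next
  case (5 a s')
  \<comment> \<open>The loop overhead of 10 per constraint is absorbed into
    \<open>102 * dim I\<close>.\<close>
  have "(num I + dim I) * (92 * dim I + 10) \<le> (num I + dim I) * (102 * dim I)"
    using dim by (intro mult_left_mono) auto
  then have le: "(num I + dim I) * (92 * dim I) + (num I + dim I) * 10 \<le> (num I + dim I) * (102 * dim I)"
    by (simp only: distrib_left)
  have ov: "7 + ncost (NAdd nM nN) = 10" "5 + ncost (NAdd nM nN) = 8" by simp_all
  have "{..<num I + dim I} \<inter> tight_cons I x = tight_cons I x" by (auto simp: tight_cons_def)
  with 5 have inv: "scan_inv I (F \<union> tight_cons I x) s'"
    and a: "a + nvar s ''r'' * (268 * (dim I)\<^sup>2)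
      \<le> (num I + dim I) * (92 * dim I) + nvar s' ''r'' * (268 * (dim I)\<^sup>2)" by simp_all
  show ?case
  proof (rule post[OF _ inv])
    show "frame {''i'', ''j'', ''k'', ''q'', ''r''} {''a'', ''b'', ''d'', ''u'', ''z''} s s'"
      using 5(2) by (rule frame_mono) auto
    show "a + (num I + dim I) * (7 + ncost (NAdd nM nN)) + (5 + ncost (NAdd nM nN)) + nvar s ''r'' * (268 * (dim I)\<^sup>2)
      \<le> (num I + dim I) * (102 * dim I) + 8 + nvar s' ''r'' * (268 * (dim I)\<^sup>2)"
      unfolding ov using a le by linarith
  qed
qed

section \<open>Sampling a step in the current subspace\<close>

definition draw :: com where
  "draw = For ''i'' nN (Sample ''u'' n0 nI)"

lemma draw_mods [simp]: "nmods draw = {''i''}" "amods draw = {''u''}"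
  by (auto simp: draw_def)

lemma wp_draw:
  assumes post: "\<And>s'. \<lbrakk>frame {''i''} {''u''} s s'; drawn s' = drawn s + nvar s ''n'';
    \<And>i. i < nvar s ''n'' \<Longrightarrow> arr s' ''u'' 0 i = \<omega> (drawn s + i)\<rbrakk> \<Longrightarrow> Q (11 * nvar s ''n'' + 6) s'"
  shows "wp \<omega> draw s Q"
  unfolding draw_def
proof (rule wp_For[where N = "nvar s ''n''" and J = "\<lambda>k a s'. a = 3 * k \<and> drawn s' = drawn s + k \<and>
      (\<forall>i<k. arr s' ''u'' 0 i = \<omega> (drawn s + i))"], goal_cases)
  case (2 k a s')
  then show ?case by (intro wp_Sample) (auto simp: less_Suc_eq)
next
  case (5 a s')
  then have "Q (11 * nvar s ''n'' + 6) s'" by (intro post) auto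
  moreover have "a + nvar s ''n'' * (7 + ncost nN) + (5 + ncost nN) = 11 * nvar s ''n'' + 6" using 5 by simp
  ultimately show ?case by simp
qed (auto simp: frameD)

definition advance :: com where
  "advance = Seq draw (Seq ortho (Seq
     (vecset ''X'' (NAdd nTau n1) (RAdd (RGet ''X'' nTau nI) (RMul (RGet ''gamma'' n0 n0) (RGet ''u'' n0 nI))))
     (NAssign ''tau'' (NAdd nTau n1))))"

lemma wp_advance:
  assumes I: "inputs_ok I s" and dim: "dim I \<ge> 1" and t: "nvar s ''tau'' = t"
    and x: "\<And>i. i < dim I \<Longrightarrow> arr s ''X'' t i = x i"
    and r: "nvar s ''r'' = r" "r \<le> 2 * dim I" and ok: "rows_ok I (tight_cons I x) r (arr s ''b'')"
    and post: "\<And>k s'. \<lbrakk>frame {''i'', ''k'', ''tau''} {''a'', ''d'', ''u'', ''X''} s s'; nvar s' ''tau'' = Suc t;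
      drawn s' = drawn s + dim I; \<And>r. r \<noteq> Suc t \<Longrightarrow> arr s' ''X'' r = arr s ''X'' r;
      \<And>i. i < dim I \<Longrightarrow> arr s' ''X'' (Suc t) i
        = x i + stepsize I * proj (dim I) (V_space I x) (\<lambda>k. \<omega> (drawn s + k)) i;
      k \<le> 265 * (dim I)\<^sup>2\<rbrakk> \<Longrightarrow> Q k s'"
  shows "wp \<omega> advance s Q"
  unfolding advance_def
proof (rule wp_Seq, rule wp_draw, rule wp_Seq)
  let ?n = "dim I" and ?B = "arr s ''b''" and ?g = "\<lambda>k. \<omega> (drawn s + k)"
  let ?rest = "Seq (vecset ''X'' (NAdd nTau n1) (RAdd (RGet ''X'' nTau nI) (RMul (RGet ''gamma'' n0 n0) (RGet ''u'' n0 nI))))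
     (NAssign ''tau'' (NAdd nTau n1))"
  have n: "nvar s ''n'' = ?n" using I by (simp add: inputs_ok_def)
  fix s1
  assume fr1: "frame {''i''} {''u''} s s1" and d1: "drawn s1 = drawn s + nvar s ''n''"
    and u1: "\<And>i. i < nvar s ''n'' \<Longrightarrow> arr s1 ''u'' 0 i = ?g i"
  show "wp \<omega> ortho s1 (\<lambda>k s'. wp \<omega> ?rest s' (\<lambda>l. Q (11 * nvar s ''n'' + 6 + (k + l))))"
  proof (rule wp_frame, rule wp_ortho[where n = ?n and B = ?B and r = r], goal_cases)
    case (5 s2)
    then have fr2: "frame {''i'', ''k''} {''a'', ''d'', ''u''} s1 s2"
      and orth2: "\<And>l. l < r \<Longrightarrow> ip ?n (arr s2 ''u'' 0) (?B l) = 0"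
      and pres2: "\<And>w. (\<And>l. l < r \<Longrightarrow> ip ?n (?B l) w = 0) \<Longrightarrow> ip ?n (arr s2 ''u'' 0) w = ip ?n (arr s1 ''u'' 0) w"
      by blast+
    show ?case
    proof (intro impI)
      assume "\<not> sampling ortho \<longrightarrow> drawn s2 = drawn s1"
      then have d2: "drawn s2 = drawn s + ?n" using d1 n by simp
      \<comment> \<open>Members of \<open>V_space\<close> vanish beyond the dimension, about which
        the array says nothing.\<close>
      define u where "u i = (if i < ?n then arr s2 ''u'' 0 i else 0)" for i
      have ip_u: "ip ?n u w = ip ?n (arr s2 ''u'' 0) w" for w
        by (rule ip_cong) (simp_all add: u_def)
      have "\<forall>k<r. ip ?n u (?B k) = 0" using orth2 by (simp add: ip_u)
      then have uV: "u \<in> V_space I x" using ok by (auto simp: V_space_iff_con rows_ok_def u_def)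
      \<comment> \<open>The vector lies in the subspace since it is orthogonal to all rows. What was
        subtracted from the sample is orthogonal to the subspace, because inner products with its
        members were preserved.\<close>
      have "proj ?n (V_space I x) ?g = u"
      proof (rule proj_unique[OF lin_subspace_V_space uV])
        fix w assume "w \<in> V_space I x"
        then have "\<forall>k<r. ip ?n w (?B k) = 0" using ok by (auto simp: V_space_iff_con rows_ok_def)
        then have "ip ?n u w = ip ?n (arr s1 ''u'' 0) w"
          unfolding ip_u by (intro pres2) (simp add: ip_commute[of _ _ w])
        also have "\<dots> = ip ?n ?g w" by (rule ip_cong) (use u1 n in auto)
        finally show "ip ?n (\<lambda>i. ?g i - u i) w = 0" by (simp add: ip_left)
      qed
      then have pr: "arr s2 ''u'' 0 i = proj ?n (V_space I x) ?g i" if "i < ?n" for i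
        using that by (simp add: u_def)
      have s2: "nvar s2 ''n'' = ?n" "nvar s2 ''tau'' = t" "arr s2 ''X'' = arr s ''X''"
          "arr s2 ''gamma'' 0 0 = stepsize I"
        using fr1 fr2 I t by (simp_all add: frameD inputs_ok_def)
      show "wp \<omega> ?rest s2 (\<lambda>l. Q (11 * nvar s ''n'' + 6 + (r * (70 * ?n + 34) + 6 + l)))"
      proof (rule wp_Seq, rule wp_frame, rule wp_vecset[where \<rho> = "Suc t"
            and E = "\<lambda>i. x i + stepsize I * proj ?n (V_space I x) ?g i"], goal_cases)
        case (1 s3)
        then show ?case using s2 by (simp add: frameD)
      next
        case (2 s3)
        then show ?case using s2 pr x by (simp add: frameD)
      next
        case (3 s3)
        then have fr3: "frame {''i''} {''X''} s2 s3"
          and X3: "\<And>r c. arr s3 ''X'' r c = (if r = Suc t \<and> c < ?n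
              then x c + stepsize I * proj ?n (V_space I x) ?g c else arr s ''X'' r c)"
          using s2 by auto
        let ?s = "set_nvar ''tau'' (nval (NAdd nTau n1) s3) s3"
        \<comment> \<open>The constant 265 is 208 for removing the rows plus 57 for sampling,
          updating the point and the counter.\<close>
        have "35 * ?n + 22 + r * (70 * ?n + 34) \<le> 265 * ?n\<^sup>2"
        proof -
          have "r * (70 * ?n + 34) \<le> 208 * ?n\<^sup>2" using dim r(2) by (rule row_cost)
          moreover have "35 * ?n + 22 \<le> 57 * ?n\<^sup>2"
            using dim self_le_power[of ?n 2] by simp
          ultimately show ?thesis by linarith
        qed
        moreover have "frame {''i'', ''k'', ''tau''} {''a'', ''d'', ''u'', ''X''} s ?s"
          using fr1 fr2 fr3 by (simp add: frame_def)
        moreover have "nvar ?s ''tau'' = Suc t" using fr3 s2 by (simp add: frameD)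
        ultimately show ?case
          using d2 X3 n s2 by (intro impI wp_NAssign post) auto
      qed
    qed
  qed (use n fr1 r ok in \<open>auto simp: frameD rows_ok_def\<close>)
qed

section \<open>The main loop\<close>

definition iteration :: com where
  "iteration = Cond (NLess nQ nN) (Seq scan (Cond (NLess nQ nN) advance Skip)) Skip"

definition edge_walk :: com where
  "edge_walk = Seq (vecset ''X'' n0 (RGet ''x'' n0 nI)) (For ''t'' (NVar ''T'') iteration)"

lemma iteration_mods [simp]:
  "nmods iteration = {''i'', ''j'', ''k'', ''q'', ''r'', ''tau''}"
  "amods iteration = {''a'', ''b'', ''d'', ''u'', ''z'', ''X''}"
  by (auto simp: iteration_def advance_def)

text \<open>Every completed iteration consumes exactly \<open>dim I\<close> samples, whatever the
  dimension of its subspace; this fixes the position of each sample.\<close>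

definition pwalk :: "ew_input \<Rightarrow> (nat \<Rightarrow> real) \<Rightarrow> nat \<Rightarrow> nat \<Rightarrow> real" where
  "pwalk I \<omega> = gwalk I (proj (dim I)) (\<lambda>(t, k). \<omega> (t * dim I + k))"

lemma pwalk_Suc:
  "pwalk I \<omega> (Suc t) = (\<lambda>i. pwalk I \<omega> t i
     + stepsize I * proj (dim I) (V_space I (pwalk I \<omega> t)) (\<lambda>k. \<omega> (t * dim I + k)) i)"
  by (simp add: pwalk_def)

lemma tight_pwalk_mono: "tight_cons I (pwalk I \<omega> t) \<subseteq> tight_cons I (pwalk I \<omega> (Suc t))"
  unfolding pwalk_Suc proj_def by (intro tight_mono gaussian_in_mem lin_subspace_V_space)

text \<open>The time \<open>a\<close> is amortised: each of the at most \<open>2 * dim I\<close> rows of \<open>b\<close> pays for its orthogonalisation.\<close>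

definition main_inv :: "ew_input \<Rightarrow> (nat \<Rightarrow> real) \<Rightarrow> nat \<Rightarrow> nat \<Rightarrow> store \<Rightarrow> bool" where
  "main_inv I \<omega> t a s \<longleftrightarrow>
     (\<forall>t'\<le>nvar s ''tau''. \<forall>i<dim I. arr s ''X'' t' i = pwalk I \<omega> t' i) \<and>
     (\<forall>t'<nvar s ''tau''. pwalk I \<omega> t' \<notin> full_set I) \<and>
     nvar s ''r'' \<le> 2 * dim I \<and>
     a \<le> t * (400 * (num I + dim I) * dim I) + nvar s ''r'' * (268 * (dim I)\<^sup>2) \<and>
     (nvar s ''q'' < dim I \<and> nvar s ''tau'' = t \<and> drawn s = t * dim I \<and>
        (\<exists>F \<subseteq> tight_cons I (pwalk I \<omega> t). scan_inv I F s) \<or>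
      \<not> nvar s ''q'' < dim I \<and> nvar s ''tau'' < t \<and> pwalk I \<omega> (nvar s ''tau'') \<in> full_set I)"

text \<open>The loop has no early exit: after a failure \<open>q\<close> stays at or above the
  dimension, the remaining rounds merely test it, and \<open>tau\<close> stays at the failing point.
  The second test in \<open>iteration\<close> catches a failure found by the scan of the same round,
  before anything is sampled in it.\<close>

lemma wp_iteration:
  assumes I: "inputs_ok I s" and dim: "dim I \<ge> 1" and inv: "main_inv I \<omega> t a s"
  shows "wp \<omega> iteration s (\<lambda>k s'. main_inv I \<omega> (Suc t) (a + k) (set_nvar ''t'' (Suc t) s'))"
proof -
  let ?n = "dim I" and ?m = "num I" and ?K = "400 * (num I + dim I) * dim I" and ?x = "pwalk I \<omega> t"
  have n: "nvar s ''n'' = ?n" using I by (simp add: inputs_ok_def)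
  have nn: "?n \<le> ?n\<^sup>2" using dim by (simp add: power2_eq_square)
  \<comment> \<open>Scan and step together need at most 102 + 20 + 265 = 387 squares of the
    dimension; 400 is a round bound. The 20 covers the constant costs of the round.\<close>
  have K: "(?m + ?n) * (102 * ?n) + 20 + 265 * ?n\<^sup>2 \<le> ?K"
  proof -
    have "?K = 400 * (?m * ?n) + 400 * ?n\<^sup>2" by (simp add: power2_eq_square algebra_simps)
    moreover have "(?m + ?n) * (102 * ?n) = 102 * (?m * ?n) + 102 * ?n\<^sup>2"
      by (simp add: power2_eq_square algebra_simps)
    ultimately show ?thesis using dim nn by linarith
  qed
  show ?thesis
    unfolding iteration_def
  proof (rule wp_Cond)
    assume "\<not> bval (NLess nQ nN) s"
    then have "\<not> nvar s ''q'' < ?n" using n by simp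
    then show "wp \<omega> Skip s (\<lambda>k s'. main_inv I \<omega> (Suc t) (a + (1 + bcost (NLess nQ nN) + k)) (set_nvar ''t'' (Suc t) s'))"
      using inv K by (intro wp_Skip) (auto simp: main_inv_def)
  next
    assume "bval (NLess nQ nN) s"
    then have "nvar s ''q'' < ?n" using n by simp
    then have tau: "nvar s ''tau'' = t" and d: "drawn s = t * ?n"
      and X: "\<And>t' i. t' \<le> t \<Longrightarrow> i < ?n \<Longrightarrow> arr s ''X'' t' i = pwalk I \<omega> t' i"
      and nf: "\<And>t'. t' < t \<Longrightarrow> pwalk I \<omega> t' \<notin> full_set I"
      and a: "a \<le> t * ?K + nvar s ''r'' * (268 * ?n\<^sup>2)"
      and "\<exists>F \<subseteq> tight_cons I ?x. scan_inv I F s"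
      using inv by (auto simp: main_inv_def)
    then obtain F where F: "F \<subseteq> tight_cons I ?x" "scan_inv I F s" by auto
    have x: "arr s ''X'' (nvar s ''tau'') i = ?x i" if "i < ?n" for i using X[of t i] that tau by simp
    show "wp \<omega> (Seq scan (Cond (NLess nQ nN) advance Skip)) s
        (\<lambda>k s'. main_inv I \<omega> (Suc t) (a + (1 + bcost (NLess nQ nN) + k)) (set_nvar ''t'' (Suc t) s'))"
    proof (rule wp_Seq, rule wp_frame, rule wp_scan[OF I dim x F(2)], assumption, intro impI)
      fix k1 s1
      assume fr1: "frame {''i'', ''j'', ''k'', ''q'', ''r''} {''a'', ''b'', ''d'', ''u'', ''z''} s s1"
        and "scan_inv I (F \<union> tight_cons I ?x) s1"
        and k1: "k1 + nvar s ''r'' * (268 * ?n\<^sup>2) \<le> (?m + ?n) * (102 * ?n) + 8 + nvar s1 ''r'' * (268 * ?n\<^sup>2)"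
        and "\<not> sampling scan \<longrightarrow> drawn s1 = drawn s"
      then have d1: "drawn s1 = t * ?n" and inv1: "scan_inv I (tight_cons I ?x) s1"
        using d F(1) by (simp_all add: Un_absorb1)
      have I1: "inputs_ok I s1" by (rule inputs_ok_frame[OF I fr1]) auto
      have s1: "nvar s1 ''tau'' = t" "arr s1 ''X'' = arr s ''X''" "nvar s1 ''n'' = ?n"
        using fr1 tau n by (simp_all add: frameD)
      have q1: "nvar s1 ''q'' < ?n \<longleftrightarrow> ?x \<notin> full_set I" and r1: "nvar s1 ''r'' \<le> 2 * ?n"
        using inv1 by (auto simp: scan_inv_def tight_disc full_set_def)
      show "wp \<omega> (Cond (NLess nQ nN) advance Skip) s1
          (\<lambda>l s'. main_inv I \<omega> (Suc t) (a + (1 + bcost (NLess nQ nN) + (k1 + l))) (set_nvar ''t'' (Suc t) s'))"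
      proof (rule wp_Cond)
        assume "\<not> bval (NLess nQ nN) s1"
        then have "\<not> nvar s1 ''q'' < ?n" using s1 by simp
        moreover have "a + (k1 + 10) \<le> Suc t * ?K + nvar s1 ''r'' * (268 * ?n\<^sup>2)"
        proof -
          have "Suc t * ?K = t * ?K + ?K" by simp
          then show ?thesis using a k1 K by linarith
        qed
        ultimately show "wp \<omega> Skip s1 (\<lambda>k s'. main_inv I \<omega> (Suc t)
            (a + (1 + bcost (NLess nQ nN) + (k1 + (1 + bcost (NLess nQ nN) + k)))) (set_nvar ''t'' (Suc t) s'))"
          using s1 X nf r1 q1 by (intro wp_Skip) (simp add: main_inv_def)
      next
        assume "bval (NLess nQ nN) s1"
        then have q: "nvar s1 ''q'' < ?n" using s1 by simp
        then have ok: "rows_ok I (tight_cons I ?x) (nvar s1 ''r'') (arr s1 ''b'')" and full: "?x \<notin> full_set I"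
          using inv1 q1 by (auto simp: scan_inv_def)
        have x1: "arr s1 ''X'' t i = ?x i" if "i < ?n" for i using X[of t i] that s1 by simp
        show "wp \<omega> advance s1 (\<lambda>k s'. main_inv I \<omega> (Suc t)
            (a + (1 + bcost (NLess nQ nN) + (k1 + (1 + bcost (NLess nQ nN) + k)))) (set_nvar ''t'' (Suc t) s'))"
        proof (rule wp_advance[OF I1 dim s1(1) x1 refl r1 ok], assumption)
          fix k2 s2
          assume fr2: "frame {''i'', ''k'', ''tau''} {''a'', ''d'', ''u'', ''X''} s1 s2"
            and tau2: "nvar s2 ''tau'' = Suc t" and d2: "drawn s2 = drawn s1 + ?n"
            and X2: "\<And>r. r \<noteq> Suc t \<Longrightarrow> arr s2 ''X'' r = arr s1 ''X'' r"
            and x2: "\<And>i. i < ?n \<Longrightarrow> arr s2 ''X'' (Suc t) i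
              = ?x i + stepsize I * proj ?n (V_space I ?x) (\<lambda>k. \<omega> (drawn s1 + k)) i"
            and k2: "k2 \<le> 265 * ?n\<^sup>2"
          have "arr s2 ''X'' t' i = pwalk I \<omega> t' i" if "t' \<le> Suc t" "i < ?n" for t' i
          proof (cases "t' = Suc t")
            case True
            then show ?thesis using x2[OF that(2)] d1 by (simp add: pwalk_Suc)
          next
            case False
            then show ?thesis using X2[OF False] s1(2) X[of t' i] that by simp
          qed
          moreover have "scan_inv I (tight_cons I ?x) s2"
            using inv1 fr2 by (subst scan_inv_cong[of _ s1]) (simp_all add: frameD)
          \<comment> \<open>The marks made at the old point remain valid at the new one. Constraints
            that have just become tight are still unmarked, which is why the invariant asks for a
            subset only.\<close>
          then have "\<exists>F \<subseteq> tight_cons I (pwalk I \<omega> (Suc t)). scan_inv I F (set_nvar ''t'' (Suc t) s2)"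
            using tight_pwalk_mono[of I \<omega> t] by (intro exI[of _ "tight_cons I ?x"]) (simp add: scan_inv_cong[of "set_nvar ''t'' (Suc t) s2" s2])
          moreover have "a + (k1 + k2 + 8) \<le> Suc t * ?K + nvar s1 ''r'' * (268 * ?n\<^sup>2)"
          proof -
            have "Suc t * ?K = t * ?K + ?K" by simp
            then show ?thesis using a k1 k2 K by linarith
          qed
          moreover have "pwalk I \<omega> t' \<notin> full_set I" if "t' < Suc t" for t'
            using that nf[of t'] full by (cases "t' = t") auto
          ultimately show "main_inv I \<omega> (Suc t)
            (a + (1 + bcost (NLess nQ nN) + (k1 + (1 + bcost (NLess nQ nN) + k2)))) (set_nvar ''t'' (Suc t) s2)"
            using fr2 tau2 d1 d2 r1 q by (simp add: main_inv_def frameD)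
        qed
      qed
    qed
  qed
qed

text \<open>A statement for each sample sequence separately, free of probability.\<close>

lemma edge_walk_correct:
  assumes valid: "valid_input I"
  shows "wp \<omega> edge_walk (init_store I) (\<lambda>k s.
    k \<le> 1000 * (iters I * num I * dim I + dim I ^ 3 + iters I * dim I ^ 2) \<and>
    output_run I s = run_of I (stop_time I (pwalk I \<omega>)) (pwalk I \<omega>))"
  unfolding edge_walk_def
proof (rule wp_Seq, rule wp_frame, rule wp_vecset[where \<rho> = 0 and E = "start I"], goal_cases)
  case (3 s)
  let ?n = "dim I" and ?m = "num I" and ?T = "iters I" and ?s = "init_store I"
  have dim: "?n \<ge> 1" using valid by (simp add: valid_input_def)
  have init: "inputs_ok I ?s" by (simp add: inputs_ok_def init_store_def)
  have fr: "frame {''i''} {''X''} ?s s"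
    and X: "\<And>r c. arr s ''X'' r c = (if r = 0 \<and> c < ?n then start I c else arr ?s ''X'' r c)"
    using 3 init by (auto simp: inputs_ok_def)
  have I: "inputs_ok I s" by (rule inputs_ok_frame[OF init fr]) auto
  have s0: "nvar s ''tau'' = 0" "nvar s ''r'' = 0" "nvar s ''q'' = 0" "arr s ''z'' = (\<lambda>_ _. 0)"
    using fr by (simp_all add: frameD init_store_def)
  show ?case
  proof (intro impI, rule wp_For[where N = ?T and J = "main_inv I \<omega>"], goal_cases)
    case 1
    then have "drawn s = 0" by (simp add: init_store_def)
    moreover have "scan_inv I {} (set_nvar ''t'' 0 s)"
      using s0 by (simp add: scan_inv_def rows_ok_def orth_rows_def)
    ultimately show ?case
      using s0 X dim unfolding main_inv_def by (auto simp: pwalk_def)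
  next
    case (2 t a s')
    then have "frame {''t'', ''i'', ''j'', ''k'', ''q'', ''r'', ''tau''} {''a'', ''b'', ''d'', ''u'', ''z'', ''X''} s s'"
      by simp
    then have "inputs_ok I s'" by (rule inputs_ok_frame[OF I]) auto
    then show ?case using 2 dim by (intro wp_iteration) auto
  next
    case 3
    then show ?case by simp
  next
    case (4 s')
    then show ?case using I by (simp add: frameD inputs_ok_def)
  next
    case (5 a s')
    then have inv: "main_inv I \<omega> ?T a s'" by simp
    define \<tau> where "\<tau> = nvar s' ''tau''"
    \<comment> \<open>At the end either \<open>tau\<close> is \<open>T\<close> or the walk is in
      \<open>full_set\<close> at time \<open>tau\<close>, and in both cases it was never there
      before.\<close>
    have stop: "stop_time I (pwalk I \<omega>) = \<tau>"
      unfolding stop_time_def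
      by (rule Least_equality) (use inv in \<open>auto simp: main_inv_def \<tau>_def not_less[symmetric]\<close>)
    have "output_run I s' = run_of I \<tau> (pwalk I \<omega>)"
      using inv unfolding output_run_def run_of_def main_inv_def by (auto simp: \<tau>_def fun_eq_iff)
    moreover have "14 * ?n + 6 + (a + ?T * 8 + 6) \<le> 1000 * (?T * ?m * ?n + ?n ^ 3 + ?T * ?n ^ 2)"
    proof -
      \<comment> \<open>At most \<open>2 * ?n\<close> rows have drawn their credit, whence 536 = 2 *
        268 below.\<close>
      have r: "nvar s' ''r'' * (268 * ?n\<^sup>2) \<le> (2 * ?n) * (268 * ?n\<^sup>2)"
        using inv by (intro mult_right_mono) (auto simp: main_inv_def)
      have "a \<le> ?T * (400 * (?m + ?n) * ?n) + nvar s' ''r'' * (268 * ?n\<^sup>2)"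
        using inv by (simp add: main_inv_def)
      also have "\<dots> \<le> ?T * (400 * (?m + ?n) * ?n) + (2 * ?n) * (268 * ?n\<^sup>2)" using r by simp
      also have "\<dots> = 400 * (?T * ?m * ?n) + 400 * (?T * ?n ^ 2) + 536 * ?n ^ 3"
        by (simp add: algebra_simps power2_eq_square power3_eq_cube)
      finally have a: "a \<le> 400 * (?T * ?m * ?n) + 400 * (?T * ?n ^ 2) + 536 * ?n ^ 3" .
      have "?n \<le> ?n ^ 3" using dim self_le_power[of ?n 3] by simp
      moreover have "?T \<le> ?T * ?n ^ 2" using dim by simp
      \<comment> \<open>With atoms in place of the monomials the estimate is linear.\<close>
      moreover have "14 * n + 6 + (a + T * 8 + 6) \<le> 1000 * (A + C + D)"
        if "n \<le> C" "T \<le> D" "a \<le> 400 * A + 400 * D + 536 * C" "1 \<le> n" for n T A C D :: nat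
      proof -
        have "14 * n + 12 + 8 * T \<le> 26 * C + 8 * D" using that by linarith
        then have "14 * n + 6 + (a + T * 8 + 6) \<le> 400 * A + 408 * D + 562 * C" using that(3) by linarith
        also have "\<dots> \<le> 1000 * A + 1000 * C + 1000 * D" by linarith
        finally show ?thesis by (simp add: distrib_left)
      qed
      ultimately show ?thesis using a dim by blast
    qed
    ultimately show ?case using stop init by (simp add: inputs_ok_def)
  qed
qed (auto simp: frameD init_store_def)

theorem theorem8:
  shows "\<exists>(p :: com) (C :: nat). \<forall>I :: ew_input. valid_input I \<longrightarrow>
    implements_edge_walk p I
      (C * (iters I * num I * dim I + dim I ^ 3 + iters I * dim I ^ 2))"
proof (intro exI allI impI)
  fix I assume valid: "valid_input I"
  let ?B = "1000 * (iters I * num I * dim I + dim I ^ 3 + iters I * dim I ^ 2)"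
  have "\<forall>\<omega>. \<exists>s k. k \<le> ?B \<and> exec \<omega> edge_walk (init_store I) k s \<and>
      output_run I s = run_of I (stop_time I (pwalk I \<omega>)) (pwalk I \<omega>)"
    using edge_walk_correct[OF valid] unfolding wp_def by blast
  \<comment> \<open>The final stores are merely chosen, one for each sample sequence. Measurability
    concerns the output alone, and that is an explicit function of the samples.\<close>
  then obtain fin where fin: "\<And>\<omega>. \<exists>k\<le>?B. exec \<omega> edge_walk (init_store I) k (fin \<omega>)"
      "\<And>\<omega>. output_run I (fin \<omega>) = run_of I (stop_time I (pwalk I \<omega>)) (pwalk I \<omega>)"
    by metis
  show "implements_edge_walk edge_walk I ?B"
    unfolding implements_edge_walk_def
  proof (intro exI[of _ fin] exI[of _ "full_set I"] conjI allI)
    show "\<exists>k\<le>?B. exec \<omega> edge_walk (init_store I) k (fin \<omega>)" for \<omega> by (rule fin)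
    show "(\<lambda>\<omega>. output_run I (fin \<omega>)) \<in> sample_space \<rightarrow>\<^sub>M run_space I"
      unfolding fin(2) pwalk_def by (rule sample_law_eq)
    show "failure_rule I (full_set I)" by (simp add: failure_rule_def full_set_def)
    show "distr sample_space (run_space I) (\<lambda>\<omega>. output_run I (fin \<omega>)) = edge_walk_law I (full_set I)"
      unfolding fin(2) pwalk_def by (rule sample_law_eq)
  qed
qed

end
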